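(* For every integral curve $\gamma=[v_1\dots v_n]\subset\mathbb{R}^3$ and every $\varepsilon>0$, there is an integral curve $\gamma'=[v_1'\dots v_n']\subset\mathbb{R}^3$ of the same length $n$ such that $|\gamma,\gamma'|_F<\varepsilon$ and $\gamma'$ can be domed.
   Context: An integral curve of length $n$ is a closed polygon $\gamma=[v_1\dots v_n]$ in $\mathbb{R}^3$ (indices mod $n$) with $|v_iv_{i+1}|=1$ for all $i$ (a side of integer length $k$ is regarded as $k$ consecutive collinear unit edges). For two integral curves $\gamma=[v_1\dots v_n]$, $\gamma'=[v_1'\dots v_n']$ of the same length, the Fréchet distance is $|\gamma,\gamma'|_F=\max_{1\le i\le n}|v_iv_i'|$. A closed polygon with unit edges $\gamma$ can be domed if there is a dome over it: a finite connected 2-dimensional simplicial complex $\Sigma$ which is a compact surface whose boundary is a single cycle, with a map $f:\Sigma\to\mathbb{R}^3$ linear on each simplex, sending every triangle to an equilateral triangle of side $1$ and sending the boundary cycle of $\Sigma$ onto $\gamma$ vertex by vertex in cyclic order (no embedding/immersion required). *)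

theory Defs
  imports "HOL-Analysis.Analysis"
begin

type_synonym point3 = "real ^ 3"

text \<open>An integral curve of length n: vertices v 0, ..., v (n-1) (indices mod n),
  consecutive vertices at distance 1.\<close>
definition integral_curve :: "nat \<Rightarrow> (nat \<Rightarrow> point3) \<Rightarrow> bool" where
  "integral_curve n v \<longleftrightarrow> (\<forall>i<n. dist (v i) (v (Suc i mod n)) = 1)"

text \<open>Frechet distance of two curves of the same length n.\<close>
definition frechet_dist :: "nat \<Rightarrow> (nat \<Rightarrow> point3) \<Rightarrow> (nat \<Rightarrow> point3) \<Rightarrow> real" where
  "frechet_dist n v w = Max {dist (v i) (w i) | i. i < n}"

text \<open>Abstract finite 2-dimensional simplicial complex given by its set of triangles
  (3-element vertex sets, vertices are natural numbers); every simplex is a face of a triangle.\<close>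
definition cx_edges :: "nat set set \<Rightarrow> nat set set" where
  "cx_edges T = {e. card e = 2 \<and> (\<exists>t\<in>T. e \<subseteq> t)}"

definition cx_boundary_edges :: "nat set set \<Rightarrow> nat set set" where
  "cx_boundary_edges T = {e \<in> cx_edges T. card {t\<in>T. e \<subseteq> t} = 1}"

definition cx_connected :: "nat set set \<Rightarrow> bool" where
  "cx_connected T \<longleftrightarrow>
     (\<forall>x\<in>\<Union>T. \<forall>y\<in>\<Union>T. (x, y) \<in> {(a, b). {a, b} \<in> cx_edges T}\<^sup>*)"

text \<open>Link of a vertex x: the graph whose edges are t - {x} for triangles t containing x.\<close>
definition cx_link_connected :: "nat set set \<Rightarrow> nat \<Rightarrow> bool" where
  "cx_link_connected T x \<longleftrightarrow>
     (\<forall>a\<in>\<Union>{t - {x} | t. t \<in> T \<and> x \<in> t}. \<forall>b\<in>\<Union>{t - {x} | t. t \<in> T \<and> x \<in> t}.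
        (a, b) \<in> {(p, q). {x, p, q} \<in> T}\<^sup>*)"

text \<open>A finite connected triangulated compact surface with boundary: every edge lies in one or
  two triangles, and the link of every vertex is connected (hence a path or a cycle).\<close>
definition surface_complex :: "nat set set \<Rightarrow> bool" where
  "surface_complex T \<longleftrightarrow>
     finite T \<and> T \<noteq> {} \<and> (\<forall>t\<in>T. card t = 3) \<and>
     (\<forall>e\<in>cx_edges T. card {t\<in>T. e \<subseteq> t} \<in> {1, 2}) \<and>
     (\<forall>x\<in>\<Union>T. cx_link_connected T x) \<and>
     cx_connected T"

text \<open>The boundary of the complex is the single cycle b 0, ..., b (n-1) of distinct vertices.\<close>
definition boundary_cycle :: "nat set set \<Rightarrow> nat \<Rightarrow> (nat \<Rightarrow> nat) \<Rightarrow> bool" where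
  "boundary_cycle T n b \<longleftrightarrow>
     inj_on b {..<n} \<and> b ` {..<n} \<subseteq> \<Union>T \<and>
     cx_boundary_edges T = {{b i, b (Suc i mod n)} | i. i < n}"

text \<open>A dome over the closed polygon v of length n.\<close>
definition is_dome :: "nat \<Rightarrow> (nat \<Rightarrow> point3) \<Rightarrow> nat set set \<Rightarrow> (nat \<Rightarrow> nat) \<Rightarrow> (nat \<Rightarrow> point3) \<Rightarrow> bool" where
  "is_dome n v T b f \<longleftrightarrow>
     surface_complex T \<and> boundary_cycle T n b \<and>
     (\<forall>x y. {x, y} \<in> cx_edges T \<longrightarrow> dist (f x) (f y) = 1) \<and>
     (\<forall>i<n. f (b i) = v i)"

definition can_be_domed :: "nat \<Rightarrow> (nat \<Rightarrow> point3) \<Rightarrow> bool" where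
  "can_be_domed n v \<longleftrightarrow> (\<exists>T b f. is_dome n v T b f)"

end

theory Submission
  imports Defs
begin

text \<open>
  Describe an integral curve by its list of unit edge vectors. Attaching triangles to the boundary
  of a dome allows two moves: an edge may be replaced by the two other sides of a triangle on it,
  and a vertex \<open>q\<close> with neighbours \<open>p\<close>, \<open>r\<close> may be replaced by \<open>q'\<close> if \<open>p\<close> and \<open>r\<close> are joined by
  a path of unit steps on the circle of points at distance \<open>1\<close> from both \<open>q\<close> and \<open>q'\<close>. By the
  intermediate value theorem such \<open>q'\<close> exist at arbitrarily small distances from \<open>q\<close>; iterating,
  they are dense in the circle described by \<open>q\<close> rotating about the line \<open>pr\<close>. So the closure of the
  set of domed curves is invariant under all rotations of two consecutive edge vectors \<open>a, b\<close>
  about \<open>a + b\<close>, provided that \<open>a + b \<noteq> 0\<close>; in particular edge vectors may be permuted.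

  It remains to see, by induction on the length, that every curve with at least four edges can be
  brought to a shape with \<open>a \<bullet> b = - 1/2\<close> for two consecutive edge vectors: these can be replaced
  by the unit vector \<open>a + b\<close>. If some products of an edge vector \<open>w\<close> with \<open>u\<close>, \<open>v\<close> lie on both
  sides of \<open>- 1/2\<close>, rotate \<open>u, v\<close> until \<open>u\<close> takes the place of \<open>v\<close>. As the edge vectors sum up
  to \<open>0\<close>, the only other possibility is that all products exceed \<open>- 1/2\<close>. Then choose \<open>u, v\<close>
  with \<open>u \<bullet> v \<le> 0\<close> and \<open>w\<close> with \<open>w \<bullet> (u + v) \<le> 0\<close>: some rotation of \<open>u\<close> about \<open>u + v\<close> makes an
  angle of at least \<open>120\<close> degrees with \<open>w\<close>.
\<close>

section \<open>Attaching triangles to a surface\<close>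

fun path_edges :: "'a list \<Rightarrow> 'a set list" where
  "path_edges (x # y # zs) = {x, y} # path_edges (y # zs)"
| "path_edges _ = []"

lemma path_edges_append:
  "path_edges (xs @ x # ys) = path_edges (xs @ [x]) @ path_edges (x # ys)"
proof (induction xs)
  case (Cons a xs)
  then show ?case by (cases xs) auto
qed simp

lemma path_edges_subset: "e \<in> set (path_edges xs) \<Longrightarrow> e \<subseteq> set xs"
  by (induction xs rule: path_edges.induct) auto

lemma path_edges_conv_nth:
  "path_edges xs = map (\<lambda>i. {xs ! i, xs ! Suc i}) [0..<length xs - 1]"
proof (induction xs rule: path_edges.induct)
  case (1 x y zs)
  have "[0..<length (x # y # zs) - 1] = 0 # map Suc [0..<length (y # zs) - 1]"
    by (simp add: upt_conv_Cons map_Suc_upt del: upt_Suc)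
  then show ?case using 1 by (simp add: o_def)
qed auto

lemma cx_edgesD: "{x, y} \<in> cx_edges T \<Longrightarrow> x \<noteq> y"
  unfolding cx_edges_def by auto

lemma cx_edgesI: "t \<in> T \<Longrightarrow> x \<in> t \<Longrightarrow> y \<in> t \<Longrightarrow> x \<noteq> y \<Longrightarrow> {x, y} \<in> cx_edges T"
  unfolding cx_edges_def by (auto simp: card_insert_if)

lemma boundary_edge_in_edges: "e \<in> cx_boundary_edges T \<Longrightarrow> e \<in> cx_edges T"
  unfolding cx_boundary_edges_def by auto

lemma cx_edge_subset: "e \<in> cx_edges T \<Longrightarrow> e \<subseteq> \<Union>T"
  unfolding cx_edges_def by auto

lemma card2_subset_triple:
  assumes "card e = 2" "e \<subseteq> {p, q, r}"
  shows "e = {p, q} \<or> e = {q, r} \<or> e = {p, r}"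
proof -
  obtain x y where "e = {x, y}" "x \<noteq> y" using assms(1) by (auto simp: card_2_iff)
  then show ?thesis using assms(2) by auto
qed

section \<open>Gluing one triangle along one or two boundary edges\<close>

lemma cx_edges_insert:
  assumes "p \<noteq> q" "q \<noteq> r" "p \<noteq> r"
  shows "cx_edges (insert {p, q, r} T) = cx_edges T \<union> {{p, q}, {q, r}, {p, r}}"
proof
  show "cx_edges (insert {p, q, r} T) \<subseteq> cx_edges T \<union> {{p, q}, {q, r}, {p, r}}"
  proof
    fix e assume "e \<in> cx_edges (insert {p, q, r} T)"
    then have "card e = 2" "e \<subseteq> {p, q, r} \<or> (\<exists>t\<in>T. e \<subseteq> t)" unfolding cx_edges_def by blast+
    then show "e \<in> cx_edges T \<union> {{p, q}, {q, r}, {p, r}}"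
      using card2_subset_triple[of e p q r] unfolding cx_edges_def by blast
  qed
  show "cx_edges T \<union> {{p, q}, {q, r}, {p, r}} \<subseteq> cx_edges (insert {p, q, r} T)"
    using assms unfolding cx_edges_def by (auto simp: card_insert_if)
qed

text \<open>The new triangle adds to the link of \<open>y\<close> the single edge \<open>ab\<close>.
  Its end \<open>a\<close> lies in the old link because \<open>ya\<close> is an old edge, so
  connectedness survives whether \<open>b\<close> is old or new.\<close>

lemma link_connected_insert:
  assumes "cx_link_connected T y" "{y, a} \<in> cx_edges T" "y \<noteq> a" "y \<noteq> b" "a \<noteq> b"
  shows "cx_link_connected (insert {y, a, b} T) y"
proof -
  define L where "L = \<Union>{t - {y} | t. t \<in> T \<and> y \<in> t}"
  define R where "R = {(p, q). {y, p, q} \<in> insert {y, a, b} T}"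
  have nodes: "\<Union>{t - {y} | t. t \<in> insert {y, a, b} T \<and> y \<in> t} = L \<union> {a, b}"
    using assms(3-5) unfolding L_def by auto
  have aL: "a \<in> L" using assms(2,3) unfolding L_def cx_edges_def by blast
  have ab: "(a, b) \<in> R" "(b, a) \<in> R" unfolding R_def by (auto simp: insert_commute)
  have LL: "(u, w) \<in> R\<^sup>*" if "u \<in> L" "w \<in> L" for u w
  proof -
    have "(u, w) \<in> {(p, q). {y, p, q} \<in> T}\<^sup>*"
      using assms(1) that unfolding cx_link_connected_def L_def by blast
    moreover have "{(p, q). {y, p, q} \<in> T} \<subseteq> R" unfolding R_def by auto
    ultimately show ?thesis using rtrancl_mono by blast
  qed
  have toa: "(u, a) \<in> R\<^sup>*" "(a, u) \<in> R\<^sup>*" if "u \<in> L \<union> {a, b}" for u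
    using that LL aL ab by auto
  have "(u, w) \<in> R\<^sup>*" if "u \<in> L \<union> {a, b}" "w \<in> L \<union> {a, b}" for u w
    using toa that by (meson rtrancl_trans)
  then show ?thesis unfolding cx_link_connected_def nodes R_def by blast
qed

lemma link_connected_insert_other:
  assumes "cx_link_connected T y" "y \<notin> t"
  shows "cx_link_connected (insert t T) y"
proof -
  have "{s - {y} | s. s \<in> insert t T \<and> y \<in> s} = {s - {y} | s. s \<in> T \<and> y \<in> s}"
    using assms(2) by auto
  moreover have "{(p, q). {y, p, q} \<in> insert t T} = {(p, q). {y, p, q} \<in> T}"
    using assms(2) by auto
  ultimately show ?thesis using assms(1) unfolding cx_link_connected_def by simp
qed

lemma link_connected_insert_new:
  assumes "y \<notin> \<Union>T" "y \<noteq> a" "y \<noteq> b" "a \<noteq> b"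
  shows "cx_link_connected (insert {y, a, b} T) y"
proof -
  have "\<Union>{t - {y} | t. t \<in> insert {y, a, b} T \<and> y \<in> t} = {a, b}"
    using assms by auto
  then show ?thesis unfolding cx_link_connected_def
    by (auto intro!: r_into_rtrancl simp: insert_commute)
qed

lemma triangles_insert:
  assumes "finite T" "t \<notin> T"
  shows "card {s \<in> insert t T. e \<subseteq> s} = card {s \<in> T. e \<subseteq> s} + (if e \<subseteq> t then 1 else 0)"
proof -
  have "{s \<in> insert t T. e \<subseteq> s} = (if e \<subseteq> t then insert t {s \<in> T. e \<subseteq> s} else {s \<in> T. e \<subseteq> s})"
    by auto
  then show ?thesis using assms by simp
qed

text \<open>Both ways of gluing at once: an ear, where \<open>r\<close> is a new vertex, and a
  notch, where two boundary edges \<open>pq\<close>, \<open>qr\<close> are closed up. As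
  \<open>pr\<close> is not an edge before, the triangle is new and no edge can get a third
  triangle.\<close>

lemma surface_insert_triangle:
  assumes S: "surface_complex T"
    and pq: "{p, q} \<in> cx_boundary_edges T"
    and pr: "{p, r} \<notin> cx_edges T"
    and qr: "{q, r} \<in> cx_boundary_edges T \<or> r \<notin> \<Union>T"
    and ne: "p \<noteq> q" "q \<noteq> r" "p \<noteq> r"
  shows "surface_complex (insert {p, q, r} T)"
    and "cx_boundary_edges (insert {p, q, r} T) =
      (cx_boundary_edges T - {{p, q}, {q, r}}) \<union> {{p, r}} \<union> (if r \<in> \<Union>T then {} else {{q, r}})"
proof -
  let ?t = "{p, q, r}"
  let ?T = "insert ?t T"
  have fin: "finite T" and c3: "\<And>t. t \<in> T \<Longrightarrow> card t = 3"
    and c12: "\<And>e. e \<in> cx_edges T \<Longrightarrow> card {t\<in>T. e \<subseteq> t} \<in> {1, 2}"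
    and lk: "\<And>x. x \<in> \<Union>T \<Longrightarrow> cx_link_connected T x" and con: "cx_connected T"
    using S unfolding surface_complex_def by blast+
  have tT: "?t \<notin> T" using pr ne cx_edgesI[of ?t T p r] by auto
  \<comment> \<open>Everything about edges follows from these counts before and after gluing:
    \<open>pq\<close> starts at 1, \<open>pr\<close> at 0, \<open>qr\<close> at 1 or 0, and of all
    edges exactly the sides of the new triangle gain one.\<close>
  define N where "N e = card {s \<in> T. e \<subseteq> s}" for e
  define M where "M e = card {s \<in> ?T. e \<subseteq> s}" for e
  have cnt_in: "M e = N e + 1" if "e \<subseteq> ?t" for e
    using triangles_insert[OF fin tT, of e] that unfolding M_def N_def by simp
  have cnt_out: "M e = N e" if "\<not> e \<subseteq> ?t" for e
    using triangles_insert[OF fin tT, of e] that unfolding M_def N_def by simp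
  have noedge: "N e = 0" if "e \<notin> cx_edges T" "card e = 2" for e
    using that fin unfolding cx_edges_def N_def by auto
  have card2: "card {p, q} = 2" "card {q, r} = 2" "card {p, r} = 2"
    using ne by auto
  have pq1: "N {p, q} = 1" using pq unfolding cx_boundary_edges_def N_def by blast
  have pr0: "N {p, r} = 0" using noedge[OF pr] card2 by blast
  have bd_r: "{q, r} \<in> cx_boundary_edges T \<longleftrightarrow> r \<in> \<Union>T"
    using qr cx_edge_subset[OF boundary_edge_in_edges, of "{q, r}" T] by blast
  have qrc: "N {q, r} = (if r \<in> \<Union>T then 1 else 0)"
  proof (cases "r \<in> \<Union>T")
    case True
    then have "N {q, r} = 1" using bd_r unfolding cx_boundary_edges_def N_def by blast
    then show ?thesis using True by simp
  next
    case False
    then have "{q, r} \<notin> cx_edges T" using cx_edge_subset[of "{q, r}" T] by auto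
    then have "N {q, r} = 0" using noedge card2 by blast
    then show ?thesis using False by simp
  qed
  have E: "cx_edges ?T = cx_edges T \<union> {{p, q}, {q, r}, {p, r}}"
    by (rule cx_edges_insert[OF ne])
  have sub: "e = {p, q} \<or> e = {q, r} \<or> e = {p, r}" if "e \<in> cx_edges ?T" "e \<subseteq> ?t" for e
  proof -
    have "card e = 2" using that unfolding cx_edges_def by blast
    then show ?thesis using card2_subset_triple[of e p q r] that(2) by blast
  qed
  have c12': "card {t\<in>?T. e \<subseteq> t} \<in> {1, 2}" if e: "e \<in> cx_edges ?T" for e
  proof (cases "e \<subseteq> ?t")
    case True
    consider "e = {p, q}" | "e = {q, r}" | "e = {p, r}" using sub[OF e True] by blast
    then have "N e \<le> 1" by cases (simp_all only: pq1 pr0 qrc, simp_all)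
    then have "M e \<in> {1, 2}" using cnt_in[OF True] by auto
    then show ?thesis unfolding M_def .
  next
    case False
    then have "e \<in> cx_edges T" using e unfolding E by auto
    then have "N e \<in> {1, 2}" using c12 unfolding N_def by blast
    then have "M e \<in> {1, 2}" using cnt_out[OF False] by simp
    then show ?thesis unfolding M_def .
  qed
  have pV: "p \<in> \<Union>T" "q \<in> \<Union>T" using cx_edge_subset[OF boundary_edge_in_edges[OF pq]] by auto
  have eq: "{p, q} \<in> cx_edges T" "{q, p} \<in> cx_edges T"
    using pq boundary_edge_in_edges by (auto simp: insert_commute)
  have lk': "cx_link_connected ?T x" if "x \<in> \<Union>?T" for x
  proof -
    consider "x \<notin> ?t" | "x = p" | "x = q" | "x = r" by blast
    then show ?thesis
    proof cases
      case 1
      then show ?thesis using link_connected_insert_other lk that by auto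
    next
      case 2
      then show ?thesis using link_connected_insert[OF lk[OF pV(1)] eq(1)] ne by simp
    next
      case 3
      then show ?thesis using link_connected_insert[OF lk[OF pV(2)] eq(2), of r] ne
        by (simp add: insert_commute)
    next
      case 4
      show ?thesis
      proof (cases "r \<in> \<Union>T")
        case True
        then have "{r, q} \<in> cx_edges T" using bd_r boundary_edge_in_edges
          by (metis insert_commute)
        then show ?thesis using link_connected_insert[OF lk[OF True], of q p] ne 4
          by (simp add: insert_commute)
      next
        case False
        then show ?thesis using link_connected_insert_new[OF False, of q p] ne 4
          by (simp add: insert_commute)
      qed
    qed
  qed
  have con': "cx_connected ?T"
  proof -
    define R where "R = {(a, b). {a, b} \<in> cx_edges ?T}"
    have "{(a, b). {a, b} \<in> cx_edges T} \<subseteq> R" unfolding R_def E by auto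
    then have TT: "(x, y) \<in> R\<^sup>*" if "x \<in> \<Union>T" "y \<in> \<Union>T" for x y
      using con that rtrancl_mono unfolding cx_connected_def by blast
    have pr': "(p, r) \<in> R" "(r, p) \<in> R" unfolding R_def E by (auto simp: insert_commute)
    have "(x, p) \<in> R\<^sup>* \<and> (p, x) \<in> R\<^sup>*" if "x \<in> \<Union>?T" for x
      using that TT pV pr' by auto
    then show ?thesis unfolding cx_connected_def R_def[symmetric] by (meson rtrancl_trans)
  qed
  show "surface_complex ?T"
    unfolding surface_complex_def using fin c3 c12' lk' con' ne by auto
  have pqr_ne: "{p, q} \<noteq> {p, r}" "{q, r} \<noteq> {p, r}" "{p, q} \<noteq> {q, r}"
    using ne by (auto simp: doubleton_eq_iff)
  show "cx_boundary_edges ?T =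
      (cx_boundary_edges T - {{p, q}, {q, r}}) \<union> {{p, r}} \<union> (if r \<in> \<Union>T then {} else {{q, r}})"
    (is "_ = ?B")
  proof (rule set_eqI)
    fix e
    have M1: "e \<in> cx_boundary_edges ?T \<longleftrightarrow> e \<in> cx_edges ?T \<and> M e = 1"
      unfolding cx_boundary_edges_def M_def by blast
    have N1: "e \<in> cx_boundary_edges T \<longleftrightarrow> e \<in> cx_edges T \<and> N e = 1"
      unfolding cx_boundary_edges_def N_def by blast
    have B: "e \<in> ?B \<longleftrightarrow> (e \<in> cx_boundary_edges T \<and> e \<noteq> {p, q} \<and> e \<noteq> {q, r}) \<or> e = {p, r} \<or>
      (e = {q, r} \<and> r \<notin> \<Union>T)"
      by (cases "r \<in> \<Union>T") (simp_all only: if_True if_False, blast+)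
    have Ee: "e \<in> cx_edges ?T \<longleftrightarrow> e \<in> cx_edges T \<or> e = {p, q} \<or> e = {q, r} \<or> e = {p, r}"
      unfolding E by blast
    consider "e = {p, q}" | "e = {q, r}" | "e = {p, r}"
      | "e \<noteq> {p, q}" "e \<noteq> {q, r}" "e \<noteq> {p, r}" by blast
    then show "e \<in> cx_boundary_edges ?T \<longleftrightarrow> e \<in> ?B"
    proof cases
      case 1
      then have "M e = 2" using cnt_in[of e] pq1 by simp
      then show ?thesis unfolding M1 B using 1 pqr_ne by simp
    next
      case 2
      then have "M e = (if r \<in> \<Union>T then 2 else 1)" using cnt_in[of e] qrc by simp
      then show ?thesis unfolding M1 B Ee using 2 pqr_ne by simp
    next
      case 3
      then have "M e = 1" using cnt_in[of e] pr0 by simp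
      then show ?thesis unfolding M1 B Ee using 3 by simp
    next
      case 4
      then have "M e = N e" if "e \<in> cx_edges ?T" using sub[OF that] cnt_out by blast
      then show ?thesis unfolding M1 B N1 using 4 Ee by metis
    qed
  qed
qed

text \<open>The boundary cycle is a list whose first vertex is repeated at the end, so that every
  modification of the boundary is a replacement inside a list.\<close>

definition dome :: "nat set set \<Rightarrow> nat list \<Rightarrow> (nat \<Rightarrow> point3) \<Rightarrow> bool" where
  "dome T bs f \<longleftrightarrow> surface_complex T \<and> hd bs = last bs \<and> distinct (tl bs) \<and> set bs \<subseteq> \<Union>T \<and>
     distinct (path_edges bs) \<and> set (path_edges bs) = cx_boundary_edges T \<and>
     (\<forall>x y. {x, y} \<in> cx_edges T \<longrightarrow> dist (f x) (f y) = 1)"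

section \<open>Ears, notches and fans on the boundary list\<close>

lemma path_edges_split2:
  "path_edges (xs @ [p, q] @ ys) = path_edges (xs @ [p]) @ [{p, q}] @ path_edges (q # ys)"
  using path_edges_append[of xs p "q # ys"] by simp

lemma path_edges_split3:
  "path_edges (xs @ [p, q, r] @ ys) = path_edges (xs @ [p]) @ [{p, q}, {q, r}] @ path_edges (r # ys)"
  using path_edges_append[of xs p "q # r # ys"] by simp

text \<open>Freshness of \<open>x\<close> makes \<open>px\<close> and \<open>qx\<close> new edges,
  so the boundary list stays free of repetitions. Over a fresh apex any position \<open>z\<close> at
  distance 1 from both ends is allowed, wherever the surface already runs.\<close>

lemma dome_add_ear:
  assumes D: "dome T (xs @ [p, q] @ ys) f" and x: "x \<notin> \<Union>T"
    and d: "dist (f p) z = 1" "dist (f q) z = 1"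
  shows "dome (insert {p, q, x} T) (xs @ [p, x, q] @ ys) (f(x := z))"
proof -
  let ?bs = "xs @ [p, q] @ ys"
  have S: "surface_complex T" and hl: "hd ?bs = last ?bs" and dis: "distinct (tl ?bs)"
    and V: "set ?bs \<subseteq> \<Union>T" and dp: "distinct (path_edges ?bs)"
    and bd: "set (path_edges ?bs) = cx_boundary_edges T"
    and len: "\<And>x y. {x, y} \<in> cx_edges T \<Longrightarrow> dist (f x) (f y) = 1"
    using D unfolding dome_def by blast+
  have xn: "x \<notin> set ?bs" using V x by blast
  have pq: "{p, q} \<in> cx_boundary_edges T" using bd unfolding path_edges_split2 by auto
  have ne: "p \<noteq> q" "q \<noteq> x" "p \<noteq> x"
    using cx_edgesD[OF boundary_edge_in_edges[OF pq]] xn by auto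
  have noex: "{u, x} \<notin> cx_edges T" for u using x cx_edge_subset by blast
  note ins = surface_insert_triangle[OF S pq noex _ ne]
  have S': "surface_complex (insert {p, q, x} T)" using ins(1) x by blast
  have bd': "cx_boundary_edges (insert {p, q, x} T) =
     (cx_boundary_edges T - {{p, q}}) \<union> {{p, x}, {q, x}}"
    using ins(2) x noex boundary_edge_in_edges by auto
  have nx: "e \<noteq> {u, x}" if "e \<in> set (path_edges (xs @ [p])) \<union> set (path_edges (q # ys))" for e u
    using that path_edges_subset[of e "xs @ [p]"] path_edges_subset[of e "q # ys"] xn by auto
  have pe: "path_edges (xs @ [p, x, q] @ ys) = path_edges (xs @ [p]) @ [{p, x}, {x, q}] @ path_edges (q # ys)"
    by (rule path_edges_split3)
  have dp': "distinct (path_edges (xs @ [p, x, q] @ ys))"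
    using dp ne nx[of _ p] nx[of _ q] unfolding path_edges_split2 pe
    by (auto simp: doubleton_eq_iff insert_commute)
  have bdl: "set (path_edges (xs @ [p, x, q] @ ys)) = cx_boundary_edges (insert {p, q, x} T)"
    using bd dp unfolding bd' path_edges_split2 pe by (auto simp: insert_commute)
  have hl': "hd (xs @ [p, x, q] @ ys) = last (xs @ [p, x, q] @ ys)"
    using hl by (cases xs) auto
  have dis': "distinct (tl (xs @ [p, x, q] @ ys))"
    using dis xn by (cases xs) auto
  have len': "dist ((f(x := z)) u) ((f(x := z)) w) = 1"
    if "{u, w} \<in> cx_edges (insert {p, q, x} T)" for u w
  proof -
    have "{u, w} \<in> cx_edges T \<or> {u, w} = {p, q} \<or> {u, w} = {q, x} \<or> {u, w} = {p, x}"
      using that unfolding cx_edges_insert[OF ne] by blast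
    then show ?thesis
      using len boundary_edge_in_edges[OF pq] noex[of u] noex[of w] d ne
      by (auto simp: doubleton_eq_iff dist_commute insert_commute)
  qed
  show ?thesis unfolding dome_def using S' hl' dis' V dp' bdl len' by auto
qed

text \<open>A combinatorial condition on \<open>pr\<close> stands beside the metric one: if
  \<open>pr\<close> were already an edge, the new triangle could be its third. The vertex
  \<open>q\<close> leaves the boundary.\<close>

lemma dome_fill_notch:
  assumes D: "dome T (xs @ [p, q, r] @ ys) f" and pr: "{p, r} \<notin> cx_edges T"
    and d: "dist (f p) (f r) = 1"
  shows "dome (insert {p, q, r} T) (xs @ [p, r] @ ys) f"
proof -
  let ?bs = "xs @ [p, q, r] @ ys"
  have S: "surface_complex T" and hl: "hd ?bs = last ?bs" and dis: "distinct (tl ?bs)"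
    and V: "set ?bs \<subseteq> \<Union>T" and dp: "distinct (path_edges ?bs)"
    and bd: "set (path_edges ?bs) = cx_boundary_edges T"
    and len: "\<And>x y. {x, y} \<in> cx_edges T \<Longrightarrow> dist (f x) (f y) = 1"
    using D unfolding dome_def by blast+
  have pq: "{p, q} \<in> cx_boundary_edges T" and qr: "{q, r} \<in> cx_boundary_edges T"
    using bd unfolding path_edges_split3 by auto
  have ne: "p \<noteq> q" "q \<noteq> r" "p \<noteq> r"
    using cx_edgesD[OF boundary_edge_in_edges[OF pq]] cx_edgesD[OF boundary_edge_in_edges[OF qr]] d
    by auto
  have rV: "r \<in> \<Union>T" using V by auto
  have S': "surface_complex (insert {p, q, r} T)"
    using surface_insert_triangle(1)[OF S pq pr _ ne] qr by blast
  have bd': "cx_boundary_edges (insert {p, q, r} T) =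
     (cx_boundary_edges T - {{p, q}, {q, r}}) \<union> {{p, r}}"
    using surface_insert_triangle(2)[OF S pq pr _ ne] qr rV by auto
  have prn: "{p, r} \<notin> set (path_edges ?bs)" using bd pr boundary_edge_in_edges by blast
  have dp': "distinct (path_edges (xs @ [p, r] @ ys))"
    using dp prn unfolding path_edges_split2 path_edges_split3 by auto
  have bdl: "set (path_edges (xs @ [p, r] @ ys)) = cx_boundary_edges (insert {p, q, r} T)"
    using bd dp unfolding bd' path_edges_split2 path_edges_split3 by auto
  have hl': "hd (xs @ [p, r] @ ys) = last (xs @ [p, r] @ ys)"
    using hl by (cases xs) auto
  have dis': "distinct (tl (xs @ [p, r] @ ys))"
    using dis by (cases xs) auto
  have len': "dist (f u) (f w) = 1" if uw: "{u, w} \<in> cx_edges (insert {p, q, r} T)" for u w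
  proof -
    consider "{u, w} \<in> cx_edges T" | "{u, w} = {p, r}"
      using uw boundary_edge_in_edges[OF pq] boundary_edge_in_edges[OF qr]
      unfolding cx_edges_insert[OF ne] by (metis Un_iff empty_iff insert_iff)
    then show ?thesis
    proof cases
      case 1
      then show ?thesis by (rule len)
    next
      case 2
      then show ?thesis using d unfolding doubleton_eq_iff by (metis dist_commute)
    qed
  qed
  show ?thesis unfolding dome_def using S' hl' dis' V dp' bdl len' by auto
qed

lemma surface_finite_vertices:
  assumes "surface_complex T"
  shows "finite (\<Union>T)"
proof (rule finite_Union)
  show "finite T" using assms unfolding surface_complex_def by blast
  show "finite t" if "t \<in> T" for t
  proof -
    have "card t = 3" using assms that unfolding surface_complex_def by blast
    then show ?thesis by (intro card_ge_0_finite) simp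
  qed
qed

lemma fresh_vertex:
  assumes "surface_complex T"
  obtains x where "x \<notin> \<Union>T"
proof -
  have "finite (\<Union>T)" by (rule surface_finite_vertices[OF assms])
  then show ?thesis using that ex_new_if_finite infinite_UNIV_nat by metis
qed

lemma dome_surface: "dome T bs f \<Longrightarrow> surface_complex T"
  unfolding dome_def by blast

lemma dome_vertices: "dome T bs f \<Longrightarrow> set bs \<subseteq> \<Union>T"
  unfolding dome_def by blast

text \<open>Ears are put on \<open>pq\<close> one after another, each new vertex taking over the
  role of \<open>p\<close>; the last triangle, on \<open>x\<close>, \<open>q\<close> and
  \<open>r\<close>, fills a notch and takes \<open>q\<close> off the boundary.\<close>

lemma dome_fan_out:
  assumes "dome T (xs @ [p, q, r] @ ys) f"
    and "zs \<noteq> []" "\<And>z. z \<in> set zs \<Longrightarrow> dist (f q) z = 1"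
    and "successively (\<lambda>x y. dist x y = 1) (f p # zs @ [f r])"
  shows "\<exists>T' ds f'. dome T' (xs @ [p] @ ds @ [r] @ ys) f' \<and> map f' ds = zs \<and>
    set ds \<inter> \<Union>T = {} \<and> (\<forall>x\<in>\<Union>T. f' x = f x)"
  using assms
proof (induction zs arbitrary: T xs p f)
  case Nil
  then show ?case by simp
next
  case (Cons z zs)
  obtain x where x: "x \<notin> \<Union>T" using fresh_vertex dome_surface[OF Cons.prems(1)] by blast
  define f1 where "f1 = f(x := z)"
  define T1 where "T1 = insert {p, q, x} T"
  have V: "set (xs @ [p, q, r] @ ys) \<subseteq> \<Union>T" by (rule dome_vertices[OF Cons.prems(1)])
  have D1: "dome T1 (xs @ [p, x, q] @ [r] @ ys) f1"
    unfolding T1_def f1_def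
    by (rule dome_add_ear[OF _ x]) (use Cons.prems in auto)
  have xq: "f1 x = z" "f1 q = f q" "f1 r = f r" "\<forall>y\<in>\<Union>T. f1 y = f y"
    using V x unfolding f1_def by auto
  show ?case
  proof (cases "zs = []")
    case True
    \<comment> \<open>The fresh \<open>x\<close> lies only in the ear, so an edge \<open>xr\<close>
      would force \<open>r = p\<close> or \<open>r = q\<close>. The former would make the boundary
      list run through the same edge twice.\<close>
    have "{x, r} \<notin> cx_edges T1"
    proof
      assume "{x, r} \<in> cx_edges T1"
      then obtain t where t: "t \<in> T1" "x \<in> t" "r \<in> t" unfolding cx_edges_def by auto
      then have "t = {p, q, x}" using x unfolding T1_def by auto
      then have rr: "r = p \<or> r = q" using t V x by auto
      have "distinct (path_edges (xs @ [p, q, r] @ ys))"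
        using Cons.prems(1) unfolding dome_def by blast
      then have "r \<noteq> p" unfolding path_edges_split3 by (auto simp: insert_commute)
      moreover have "{q, r} \<in> cx_boundary_edges T"
        using Cons.prems(1) unfolding dome_def path_edges_split3 by auto
      then have "r \<noteq> q" using cx_edgesD[OF boundary_edge_in_edges] by blast
      ultimately show False using rr by blast
    qed
    then have "dome (insert {x, q, r} T1) ((xs @ [p]) @ [x, r] @ ys) f1"
      by (intro dome_fill_notch) (use D1 True Cons.prems xq in auto)
    then show ?thesis using xq x True
      by (intro exI[of _ "insert {x, q, r} T1"] exI[of _ "[x]"] exI[of _ f1]) auto
  next
    case False
    have "\<exists>T' ds f'. dome T' ((xs @ [p]) @ [x] @ ds @ [r] @ ys) f' \<and> map f' ds = zs \<and>
      set ds \<inter> \<Union>T1 = {} \<and> (\<forall>y\<in>\<Union>T1. f' y = f1 y)"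
      by (rule Cons.IH) (use D1 False Cons.prems xq in auto)
    then obtain T' ds f' where *: "dome T' ((xs @ [p]) @ [x] @ ds @ [r] @ ys) f'" "map f' ds = zs"
      "set ds \<inter> \<Union>T1 = {}" "\<forall>y\<in>\<Union>T1. f' y = f1 y" by (elim exE conjE)
    have T1: "x \<in> \<Union>T1" "\<Union>T \<subseteq> \<Union>T1" unfolding T1_def by auto
    show ?thesis
    proof (intro exI conjI)
      show "dome T' (xs @ [p] @ (x # ds) @ [r] @ ys) f'" using *(1) by simp
      show "map f' (x # ds) = z # zs" using *(2) bspec[OF *(4) T1(1)] xq(1) by simp
      show "set (x # ds) \<inter> \<Union>T = {}"
        using disjoint_iff[THEN iffD1, OF *(3)] subsetD[OF T1(2)] x
        by (metis disjoint_iff insert_iff list.simps(15))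
      show "\<forall>y\<in>\<Union>T. f' y = f y" using *(4) subsetD[OF T1(2)] xq(4) by metis
    qed
  qed
qed

text \<open>The fan with apex \<open>x\<close> is filled from the end at \<open>r\<close> towards
  \<open>p\<close>: the corner at the last vertex of \<open>ds\<close> is closed by a chord to
  \<open>x\<close>, and \<open>ds\<close> gets shorter. The last vertex of \<open>p # ds\<close> is
  exempt from the chord condition because a boundary edge already joins it to
  \<open>x\<close>.\<close>

lemma dome_fan_in:
  assumes "dome T (xs @ [p] @ ds @ [x, r] @ ys) f"
    and "\<And>d. d \<in> set (p # ds) \<Longrightarrow> dist (f d) (f x) = 1"
    and "\<And>d. d \<in> set (butlast (p # ds)) \<Longrightarrow> {d, x} \<notin> cx_edges T"
    and "distinct (p # ds)"
  shows "\<exists>T'. dome T' (xs @ [p, x, r] @ ys) f"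
  using assms
proof (induction ds arbitrary: T rule: rev_induct)
  case Nil
  then show ?case by auto
next
  case (snoc d ds)
  define l where "l = last (p # ds)"
  define ws where "ws = xs @ butlast (p # ds)"
  have pds: "p # ds = butlast (p # ds) @ [l]" unfolding l_def by simp
  have lmem: "l \<in> set (butlast (p # ds @ [d]))" unfolding l_def by (auto simp: butlast_append)
  have list: "xs @ [p] @ (ds @ [d]) @ [x, r] @ ys = ws @ [l, d, x] @ [r] @ ys"
    unfolding ws_def using pds by (metis append.assoc append_Cons append_Nil)
  have list2: "ws @ [l, x] @ [r] @ ys = xs @ [p] @ ds @ [x, r] @ ys"
    unfolding ws_def using pds by (metis append.assoc append_Cons append_Nil)
  have lx: "{l, x} \<notin> cx_edges T" using snoc.prems(3)[OF lmem] .
  have ld: "dist (f l) (f x) = 1" using snoc.prems(2) lmem by (meson in_set_butlastD)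
  have D': "dome (insert {l, d, x} T) (xs @ [p] @ ds @ [x, r] @ ys) f"
    using dome_fill_notch[of T ws l d x "[r] @ ys" f] lx ld snoc.prems(1) unfolding list list2 by simp
  show ?case
  proof (rule snoc.IH[OF D'])
    fix e assume e: "e \<in> set (butlast (p # ds))"
    \<comment> \<open>The new edges all run between \<open>l\<close>, \<open>d\<close> and
      \<open>x\<close>; by distinctness of the list, \<open>ex\<close> is none of them.\<close>
    have "distinct (butlast (p # ds) @ [l, d])"
      using snoc.prems(4) pds by (metis append.assoc append_Cons append_Nil)
    then have el: "e \<noteq> l" "e \<noteq> d" using e by auto
    have eT: "{e, x} \<notin> cx_edges T" using snoc.prems(3) e by (metis append_Cons butlast_snoc in_set_butlastD)
    have dx: "l \<noteq> d" "d \<noteq> x" "l \<noteq> x"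
    proof -
      show "l \<noteq> d" using \<open>distinct (butlast (p # ds) @ [l, d])\<close> by auto
      show "l \<noteq> x" using ld by auto
      have "dist (f d) (f x) = 1" using snoc.prems(2) by auto
      then show "d \<noteq> x" by auto
    qed
    show "{e, x} \<notin> cx_edges (insert {l, d, x} T)"
      unfolding cx_edges_insert[OF dx] using eT el dx by (auto simp: doubleton_eq_iff)
  qed (use snoc.prems in auto)
qed

text \<open>The vertex \<open>q\<close> is replaced by a new vertex over \<open>y\<close>. First the fan of triangles with apex
  \<open>q\<close> over the path \<open>p, zs, r\<close> is attached, then the fan with the new apex. All chords that
  get filled have a fresh endpoint, so no edge is ever used three times.\<close>

lemma dome_fan:
  assumes D: "dome T (xs @ [p, q, r] @ ys) f"
    and zs: "zs \<noteq> []" "\<And>z. z \<in> set zs \<Longrightarrow> dist (f q) z = 1" "\<And>z. z \<in> set zs \<Longrightarrow> dist y z = 1"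
    and chain: "successively (\<lambda>x y. dist x y = 1) (f p # zs @ [f r])"
    and y: "dist (f p) y = 1" "dist (f r) y = 1"
  shows "\<exists>T' x f'. dome T' (xs @ [p, x, r] @ ys) f' \<and> f' x = y \<and> x \<notin> \<Union>T \<and> (\<forall>u\<in>\<Union>T. f' u = f u)"
proof -
  have "\<exists>T' ds f'. dome T' (xs @ [p] @ ds @ [r] @ ys) f' \<and> map f' ds = zs \<and>
      set ds \<inter> \<Union>T = {} \<and> (\<forall>x\<in>\<Union>T. f' x = f x)"
    by (rule dome_fan_out[OF D zs(1) _ chain]) (rule zs(2))
  then obtain T1 ds f1 where 1: "dome T1 (xs @ [p] @ ds @ [r] @ ys) f1" "map f1 ds = zs"
    "set ds \<inter> \<Union>T = {}" "\<forall>x\<in>\<Union>T. f1 x = f x"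
    by (elim exE conjE)
  have V: "set (xs @ [p, q, r] @ ys) \<subseteq> \<Union>T" by (rule dome_vertices[OF D])
  have V1: "set (xs @ [p] @ ds @ [r] @ ys) \<subseteq> \<Union>T1" by (rule dome_vertices[OF 1(1)])
  \<comment> \<open>The complex \<open>T1\<close> is not recorded as containing \<open>T\<close>, so
    \<open>x\<close> has to avoid both.\<close>
  have finT: "finite (\<Union>T1 \<union> \<Union>T)"
    using surface_finite_vertices dome_surface[OF 1(1)] dome_surface[OF D] by blast
  obtain x where x: "x \<notin> \<Union>T1" "x \<notin> \<Union>T"
    using ex_new_if_finite[OF infinite_UNIV_nat finT] by auto
  define l where "l = last ds"
  have ds0: "ds \<noteq> []" using 1(2) zs(1) by auto
  then have ds: "ds = butlast ds @ [l]" unfolding l_def by simp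
  have ldzs: "f1 d \<in> set zs" if "d \<in> set ds" for d using 1(2) that by (metis image_eqI list.set_map)
  define f2 where "f2 = f1(x := y)"
  have fr: "f1 r = f r" "f1 p = f p" using V 1(4) by auto
  \<comment> \<open>An ear over the last edge \<open>lr\<close> introduces the new apex; the
    remaining triangles of its fan are notches.\<close>
  have D2: "dome (insert {l, r, x} T1) ((xs @ [p] @ butlast ds) @ [l, x, r] @ ys) f2"
    unfolding f2_def
  proof (rule dome_add_ear[OF _ x(1)])
    show "dome T1 ((xs @ [p] @ butlast ds) @ [l, r] @ ys) f1"
      using 1(1) ds by (metis append.assoc append_Cons append_Nil)
    show "dist (f1 l) y = 1"
      using zs(3)[OF ldzs[of l]] ds0 unfolding l_def by (simp add: dist_commute)
    show "dist (f1 r) y = 1" using y fr by simp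
  qed
  have D3: "dome (insert {l, r, x} T1) (xs @ [p] @ ds @ [x, r] @ ys) f2"
    using D2 ds by (metis append.assoc append_Cons append_Nil)
  have dist_pds: "distinct (p # ds)"
  proof -
    have "distinct (tl (xs @ [p] @ ds @ [r] @ ys))" using 1(1) unfolding dome_def by blast
    then have "distinct ds" by (cases xs) auto
    then show ?thesis using V 1(3) by auto
  qed
  have "\<exists>T'. dome T' (xs @ [p, x, r] @ ys) f2"
  proof (rule dome_fan_in[OF D3])
    fix d assume d: "d \<in> set (p # ds)"
    then have "d \<noteq> x" using V1 x by auto
    then show "dist (f2 d) (f2 x) = 1"
      using d y fr zs(3)[OF ldzs[of d]] unfolding f2_def by (auto simp: dist_commute)
  next
    fix d assume d: "d \<in> set (butlast (p # ds))"
    have "distinct (butlast (p # ds) @ [l])" using dist_pds ds ds0 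
      by (metis append_Cons butlast.simps(2))
    then have dl: "d \<noteq> l" using d by auto
    have "d \<in> set (p # ds)" using d by (rule in_set_butlastD)
    have dr: "d \<noteq> r"
    proof -
      have "r \<noteq> p"
      proof -
        have "distinct (path_edges (xs @ [p, q, r] @ ys))"
          using D unfolding dome_def by blast
        then show ?thesis unfolding path_edges_split3 by (auto simp: insert_commute)
      qed
      moreover have "r \<notin> set ds" using V 1(3) by auto
      ultimately show ?thesis using \<open>d \<in> set (p # ds)\<close> by auto
    qed
    have dx: "d \<noteq> x" using \<open>d \<in> set (p # ds)\<close> V1 x by auto
    show "{d, x} \<notin> cx_edges (insert {l, r, x} T1)"
    proof
      assume "{d, x} \<in> cx_edges (insert {l, r, x} T1)"
      then obtain t where t: "t \<in> insert {l, r, x} T1" "x \<in> t" "d \<in> t" unfolding cx_edges_def by auto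
      then have "t = {l, r, x}" using x by auto
      then show False using t dl dr dx by auto
    qed
  qed (use dist_pds in auto)
  then obtain T' where "dome T' (xs @ [p, x, r] @ ys) f2" by blast
  moreover have "f2 x = y" "\<forall>u\<in>\<Union>T. f2 u = f u" unfolding f2_def using x 1(4) by auto
  ultimately show ?thesis using x by blast
qed

text \<open>Base of the induction on the length of the curve.\<close>

lemma dome_single_triangle:
  assumes "dist (f 0) (f 1) = 1" "dist (f 1) (f 2) = 1" "dist (f 0) (f 2) = 1"
  shows "dome {{0, 1, 2}} [0, 1, 2, 0] f"
proof -
  have E: "cx_edges {{0, 1, 2}} = {{0, 1}, {1, 2}, {0, 2}}"
    using cx_edges_insert[of 0 1 2 "{}"] by (simp add: cx_edges_def)
  have one: "card {t \<in> {{0, 1, 2}}. e \<subseteq> t} = 1" if "e \<in> cx_edges {{0, 1, 2::nat}}" for e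
  proof -
    have "{t \<in> {{0, 1, 2}}. e \<subseteq> t} = {{0, 1, 2}}" using that unfolding cx_edges_def by auto
    then show ?thesis by simp
  qed
  have B: "cx_boundary_edges {{0, 1, 2}} = {{0, 1}, {1, 2}, {0, 2}}"
    using one unfolding cx_boundary_edges_def E by blast
  have L: "cx_link_connected {{0, 1, 2}} x" if "x \<in> {0, 1, 2}" for x
    using that link_connected_insert_new[of 0 "{}" 1 2] link_connected_insert_new[of 1 "{}" 0 2]
      link_connected_insert_new[of 2 "{}" 0 1] by (auto simp: insert_commute)
  have C: "cx_connected {{0, 1, 2}}"
    unfolding cx_connected_def
  proof (intro ballI)
    fix x y :: nat assume "x \<in> \<Union>{{0, 1, 2}}" "y \<in> \<Union>{{0, 1, 2}}"
    then have "x = y \<or> (x, y) \<in> {(a, b). {a, b} \<in> cx_edges {{0, 1, 2}}}"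
      using cx_edgesI[of "{0,1,2}" "{{0,1,2}}" x y] by blast
    then show "(x, y) \<in> {(a, b). {a, b} \<in> cx_edges {{0, 1, 2}}}\<^sup>*" by auto
  qed
  have "surface_complex {{0, 1, 2}}"
    unfolding surface_complex_def using one L C by auto
  moreover have "dist (f x) (f y) = 1" if "{x, y} \<in> cx_edges {{0, 1, 2}}" for x y
    using that assms unfolding E by (auto simp: doubleton_eq_iff dist_commute)
  ultimately show ?thesis unfolding dome_def B by (auto simp: doubleton_eq_iff insert_commute)
qed

section \<open>Rotating two unit edges about their sum\<close>

text \<open>The positions of the middle vertex of a path of two unit edges from \<open>0\<close> to \<open>s\<close>.\<close>

definition hinge :: "point3 \<Rightarrow> point3 set" where
  "hinge s = {a. norm a = 1 \<and> norm (s - a) = 1}"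

text \<open>Two positions of the middle vertex that a pair of fans can exchange: both are apexes
  over a common path of unit steps from \<open>0\<close> to \<open>s\<close>, which is what
  \<open>dome_fan\<close> asks for after a translation.\<close>

definition fan_pair :: "point3 \<Rightarrow> point3 \<Rightarrow> point3 \<Rightarrow> bool" where
  "fan_pair s a b \<longleftrightarrow> a \<in> hinge s \<and> b \<in> hinge s \<and>
     (\<exists>zs. zs \<noteq> [] \<and> (\<forall>z\<in>set zs. dist a z = 1 \<and> dist b z = 1) \<and>
       successively (\<lambda>x y. dist x y = 1) (0 # zs @ [s]))"

text \<open>Here \<open>2 * t\<close> is the angle under which a unit chord is seen from the centre of a circle of
  radius \<open>1 / (2 * sin t)\<close>, and \<open>k\<close> such chords in a row span a chord of length \<open>l\<close>. At
  \<open>t = pi / 6\<close> the chords close up after six steps; for large \<open>k\<close> a slight increase of \<open>t\<close>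
  makes \<open>sin (k * t)\<close> sweep through all of \<open>[0, 1]\<close>.\<close>

lemma fan_angle:
  fixes l \<delta> :: real
  assumes "0 < l" "l < 2" "\<delta> > 0"
  obtains k :: nat and t :: real where "k \<ge> 2" "sin t > 1/2" "sin (real k * t) = l * sin t"
    "l * sin t < 1" "4 - 1 / (sin t)\<^sup>2 < \<delta>"
proof -
  have s6: "sin (pi/6) = 1/2" by (rule sin_30)
  have "((\<lambda>t. l * sin t) \<longlongrightarrow> l * sin (pi/6)) (at_right (pi/6))"
    by (intro tendsto_intros)
  then have "\<forall>\<^sub>F t in at_right (pi/6). l * sin t < 1"
    using assms s6 by (intro order_tendstoD) auto
  moreover have "((\<lambda>t. 4 - 1 / (sin t)\<^sup>2) \<longlongrightarrow> 4 - 1 / (sin (pi/6))\<^sup>2) (at_right (pi/6))"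
    by (intro tendsto_intros) (use s6 in auto)
  then have "\<forall>\<^sub>F t in at_right (pi/6). 4 - 1 / (sin t)\<^sup>2 < \<delta>"
    using assms s6 by (intro order_tendstoD) (auto simp: power2_eq_square)
  ultimately have "\<forall>\<^sub>F t in at_right (pi/6). l * sin t < 1 \<and> 4 - 1 / (sin t)\<^sup>2 < \<delta>"
    by eventually_elim simp
  then obtain b where b: "b > pi/6"
    "\<And>t. pi/6 < t \<Longrightarrow> t < b \<Longrightarrow> l * sin t < 1 \<and> 4 - 1 / (sin t)\<^sup>2 < \<delta>"
    unfolding eventually_at_right_field by blast
  \<comment> \<open>\<open>m\<close> is so large that a quarter turn spread over
    \<open>12 * m\<close> steps keeps \<open>u\<close> below \<open>b\<close>.\<close>
  obtain m where m: "pi / (24 * (b - pi/6)) < real m" using reals_Archimedean2 by blast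
  have m0: "real m > 0"
    using b m pi_gt_zero by (smt (verit) divide_nonneg_nonneg)
  define u where "u = pi/6 + pi / (24 * real m)"
  have ub: "u < b" using m m0 b unfolding u_def by (simp add: field_simps)
  have m1: "real m \<ge> 1" using m0 by (simp add: Suc_leI)
  have u2: "pi/6 < u" "u \<le> pi/2"
  proof -
    show "pi/6 < u" unfolding u_def using m0 by simp
    have "pi / (24 * real m) \<le> pi / 24" using m1 by (simp add: field_simps)
    then show "u \<le> pi/2" unfolding u_def using pi_gt_zero by linarith
  qed
  \<comment> \<open>The total angle \<open>k * t\<close> is \<open>m\<close> full turns at
    \<open>pi/6\<close> and a quarter turn more at \<open>u\<close>, so \<open>g\<close> changes
    sign in between.\<close>
  define k where "k = 12 * m"
  define g where "g t = sin (real k * t) - l * sin t" for t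
  have "real k * (pi/6) = 2 * pi * real m" unfolding k_def by simp
  then have "sin (real k * (pi/6)) = 0" using sin_2npi[of m] by (simp add: mult_ac)
  then have g0: "g (pi/6) < 0" unfolding g_def using s6 assms(1) by simp
  have "real k * u = 2 * pi * real m + pi/2" unfolding k_def u_def using m0 by (simp add: field_simps)
  then have "sin (real k * u) = 1" using sin_2npi[of m] cos_2npi[of m] by (simp add: sin_add mult_ac)
  then have g1: "g u > 0" unfolding g_def using b(2)[OF u2(1) ub] by simp
  have "\<exists>t\<ge>pi/6. t \<le> u \<and> g t = 0"
    by (rule IVT') (use g0 g1 u2 in \<open>auto simp: g_def intro!: continuous_intros\<close>)
  then obtain t where t: "pi/6 \<le> t" "t \<le> u" "g t = 0" by blast
  have t6: "pi/6 < t" using t g0 by (cases "t = pi/6") auto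
  have "sin (pi/6) < sin t" using t6 t u2 pi_gt_zero by (intro sin_monotone_2pi) auto
  then have "sin t > 1/2" using s6 by simp
  moreover have "k \<ge> 2" using m1 unfolding k_def by simp
  moreover have "sin (real k * t) = l * sin t" using t(3) unfolding g_def by simp
  ultimately show thesis using that b(2)[OF t6] t(2) ub by simp
qed

text \<open>This is a circle of radius \<open>r\<close> with the usual chord length. Dividing by
  \<open>c\<close> and \<open>d\<close>, of either sign, allows orthogonal vectors \<open>X\<close>
  and \<open>Y\<close> of different lengths.\<close>

lemma dist_circle_points:
  fixes X Y :: "'a::real_inner"
  assumes "X \<bullet> Y = 0" "(norm X)\<^sup>2 = r\<^sup>2 * c\<^sup>2" "(norm Y)\<^sup>2 = r\<^sup>2 * d\<^sup>2" "c \<noteq> 0" "d \<noteq> 0"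
  shows "(norm ((cos u / c) *\<^sub>R X + (sin u / d) *\<^sub>R Y))\<^sup>2 = r\<^sup>2"
    and "(norm (((cos u / c) *\<^sub>R X + (sin u / d) *\<^sub>R Y) - ((cos v / c) *\<^sub>R X + (sin v / d) *\<^sub>R Y)))\<^sup>2
      = (2 * r * sin ((u - v) / 2))\<^sup>2"
proof -
  have comb: "(norm (p *\<^sub>R X + q *\<^sub>R Y))\<^sup>2 = p\<^sup>2 * (norm X)\<^sup>2 + q\<^sup>2 * (norm Y)\<^sup>2" for p q
    using assms(1) unfolding power2_norm_eq_inner
    by (simp add: inner_add_left inner_add_right inner_commute power2_eq_square)
  have "(norm ((cos u / c) *\<^sub>R X + (sin u / d) *\<^sub>R Y))\<^sup>2 = r\<^sup>2 * ((cos u)\<^sup>2 + (sin u)\<^sup>2)"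
    unfolding comb assms(2,3) distrib_left using assms(4,5) by (simp add: power_divide)
  then show "(norm ((cos u / c) *\<^sub>R X + (sin u / d) *\<^sub>R Y))\<^sup>2 = r\<^sup>2"
    by simp
  have "((cos u / c) *\<^sub>R X + (sin u / d) *\<^sub>R Y) - ((cos v / c) *\<^sub>R X + (sin v / d) *\<^sub>R Y)
     = ((cos u - cos v) / c) *\<^sub>R X + ((sin u - sin v) / d) *\<^sub>R Y"
    by (simp add: diff_divide_distrib scaleR_left_diff_distrib)
  moreover have "(norm (((cos u - cos v) / c) *\<^sub>R X + ((sin u - sin v) / d) *\<^sub>R Y))\<^sup>2
     = r\<^sup>2 * ((cos u - cos v)\<^sup>2 + (sin u - sin v)\<^sup>2)"
    unfolding comb assms(2,3) distrib_left using assms(4,5) by (simp add: power_divide)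
  moreover have "(cos u - cos v)\<^sup>2 + (sin u - sin v)\<^sup>2 = 4 * (sin ((u - v) / 2))\<^sup>2"
  proof -
    have "(cos u - cos v)\<^sup>2 + (sin u - sin v)\<^sup>2 = ((cos u)\<^sup>2 + (sin u)\<^sup>2) + ((cos v)\<^sup>2 + (sin v)\<^sup>2)
       - 2 * (cos u * cos v + sin u * sin v)"
      by (simp add: power2_eq_square algebra_simps)
    also have "\<dots> = 2 - 2 * cos (u - v)" by (simp add: cos_diff)
    also have "\<dots> = 4 * (sin ((u - v) / 2))\<^sup>2"
      using cos_double_sin[of "(u - v) / 2"] by (simp only: times_divide_eq_right nonzero_mult_div_cancel_left) simp
    finally show ?thesis .
  qed
  ultimately show "(norm (((cos u / c) *\<^sub>R X + (sin u / d) *\<^sub>R Y) - ((cos v / c) *\<^sub>R X + (sin v / d) *\<^sub>R Y)))\<^sup>2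
      = (2 * r * sin ((u - v) / 2))\<^sup>2"
    by (simp add: power_mult_distrib)
qed

section \<open>The circle of middle vertices and walks on it\<close>

lemma hinge_inner:
  assumes "a \<in> hinge s"
  shows "a \<bullet> a = 1" "s \<bullet> a = (s \<bullet> s) / 2"
proof -
  show a: "a \<bullet> a = 1" using assms unfolding hinge_def by (simp add: norm_eq_1)
  have "(s - a) \<bullet> (s - a) = 1" using assms unfolding hinge_def by (simp add: norm_eq_1)
  then show "s \<bullet> a = (s \<bullet> s) / 2" using a
    by (simp add: inner_diff_left inner_diff_right inner_commute)
qed

lemma hingeI:
  assumes "a \<bullet> a = 1" "s \<bullet> a = (s \<bullet> s) / 2"
  shows "a \<in> hinge s"
  using assms unfolding hinge_def norm_eq_1 mem_Collect_eq
  by (simp add: inner_diff_left inner_diff_right inner_commute)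

lemma successively_upt:
  assumes "\<And>j. i \<le> j \<Longrightarrow> Suc j < k \<Longrightarrow> P (z j) (z (Suc j))"
  shows "successively P (map z [i..<k])"
  using assms
proof (induction "k - i" arbitrary: i)
  case (Suc d)
  then have "[i..<k] = i # [Suc i..<k]" by (simp add: upt_conv_Cons)
  moreover have "successively P (map z [Suc i..<k])" using Suc by auto
  moreover have "P (z i) (hd (map z [Suc i..<k]))" if "Suc i < k"
    using Suc.prems[of i] that by (simp add: upt_conv_Cons)
  ultimately show ?case by (cases "Suc i < k") (simp_all add: successively_Cons)
qed simp

text \<open>The points at distance 1 from both \<open>a\<close> and \<open>b\<close> form a circle
  about their midpoint \<open>m\<close> of radius \<open>r = 1 / (2 * sin t)\<close>, which passes
  through \<open>0\<close> and \<open>s\<close>. A chord seen under the angle \<open>2 * t\<close>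
  has length \<open>2 * r * sin t = 1\<close>, and \<open>k\<close> of them in a row span
  \<open>2 * r * sin (k * t) = norm s\<close>.\<close>

lemma fan_pairI:
  assumes ab: "a \<in> hinge s" "b \<in> hinge s" and s0: "s \<noteq> 0"
    and k: "k \<ge> 2" and t: "sin t > 0" and eq: "sin (real k * t) = norm s * sin t" "norm s * sin t < 1"
    and d: "(dist a b)\<^sup>2 = 4 - 1 / (sin t)\<^sup>2"
  shows "fan_pair s a b"
proof -
  define m where "m = (1/2) *\<^sub>R (a + b)"
  define D where "D = (1/2) *\<^sub>R (a - b)"
  \<comment> \<open>\<open>X\<close> leads from the centre \<open>m\<close> to the midpoint of the
    chord from \<open>0\<close> to \<open>s\<close>, and \<open>Y\<close> is half of that
    chord.\<close>
  define X where "X = (1/2) *\<^sub>R s - m"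
  define Y where "Y = (1/2) *\<^sub>R s"
  define r where "r = 1 / (2 * sin t)"
  define c where "c = cos (real k * t)"
  define e where "e = sin (real k * t)"
  have am: "a = m + D" "b = m - D" unfolding m_def D_def by (simp_all add: algebra_simps flip: scaleR_left_distrib)
  have sm: "s \<bullet> m = (s \<bullet> s) / 2" "s \<bullet> D = 0"
    unfolding m_def D_def using hinge_inner[OF ab(1)] hinge_inner[OF ab(2)]
    by (simp_all add: inner_add_right inner_diff_right)
  have DD: "D \<bullet> D = 1 - r\<^sup>2"
  proof -
    have "D \<bullet> D = (dist a b)\<^sup>2 / 4"
      unfolding D_def dist_norm power2_norm_eq_inner by simp
    then show ?thesis unfolding d r_def by (simp add: power_divide power_mult_distrib diff_divide_distrib)
  qed
  have "a \<bullet> a = m \<bullet> m + 2 * (m \<bullet> D) + D \<bullet> D" "b \<bullet> b = m \<bullet> m - 2 * (m \<bullet> D) + D \<bullet> D"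
    unfolding am by (simp_all add: inner_add_left inner_add_right inner_diff_left inner_diff_right inner_commute)
  then have mD: "m \<bullet> D = 0" and mm: "m \<bullet> m = r\<^sup>2"
    using hinge_inner(1)[OF ab(1)] hinge_inner(1)[OF ab(2)] DD by auto
  have XY: "X \<bullet> Y = 0" and XD: "X \<bullet> D = 0" and YD: "Y \<bullet> D = 0"
    unfolding X_def Y_def using sm mD
    by (simp_all add: inner_diff_left inner_diff_right inner_commute)
  have e: "e = norm s * sin t" using eq unfolding e_def by simp
  have s2: "norm s = 2 * r * e" unfolding e r_def using t by simp
  have YY: "(norm Y)\<^sup>2 = r\<^sup>2 * e\<^sup>2" unfolding Y_def using s2 by (simp add: power_mult_distrib power_divide)
  have XX: "(norm X)\<^sup>2 = r\<^sup>2 * c\<^sup>2"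
  proof -
    have "(norm X)\<^sup>2 = (s \<bullet> s) / 4 - s \<bullet> m + m \<bullet> m"
      unfolding X_def power2_norm_eq_inner by (simp add: inner_diff_left inner_diff_right inner_commute)
    also have "\<dots> = r\<^sup>2 - (norm s)\<^sup>2 / 4" using sm mm by (simp add: power2_norm_eq_inner)
    also have "\<dots> = r\<^sup>2 * (1 - e\<^sup>2)" unfolding s2 by (simp add: power_mult_distrib algebra_simps)
    also have "1 - e\<^sup>2 = c\<^sup>2" unfolding c_def e_def by (simp add: cos_squared_eq)
    finally show ?thesis .
  qed
  have e0: "e > 0" "e < 1" using e eq s0 t by auto
  \<comment> \<open>\<open>X\<close> vanishes only if the chord is a diameter, which
    \<open>norm s * sin t < 1\<close> excludes.\<close>
  have c0: "c \<noteq> 0"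
  proof
    assume "c = 0"
    then have "e\<^sup>2 = 1" unfolding c_def e_def by (simp add: sin_squared_eq)
    then show False using e0 by (simp add: power2_eq_1_iff)
  qed
  define P where "P u = (cos u / c) *\<^sub>R X + (sin u / e) *\<^sub>R Y" for u
  \<comment> \<open>A walk from \<open>0\<close> to \<open>s\<close> on the circle with axis \<open>ab\<close>, which contains both points.\<close>
  define z where "z j = m + P ((2 * real j - real k) * t)" for j
  note circ = dist_circle_points[OF XY XX YY c0]
  have Pn: "(norm (P u))\<^sup>2 = r\<^sup>2" for u
    unfolding P_def using circ(1) e0 by simp
  have PP: "norm (P u - P v) = 1" if "u - v = 2 * t \<or> v - u = 2 * t" for u v
  proof -
    have "(norm (P u - P v))\<^sup>2 = (2 * r * sin ((u - v) / 2))\<^sup>2"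
      unfolding P_def using circ(2) e0 by simp
    also have "(sin ((u - v) / 2))\<^sup>2 = (sin t)\<^sup>2"
    proof -
      have "(u - v) / 2 = t \<or> (u - v) / 2 = - t" using that by auto
      then show ?thesis by auto
    qed
    then have "(2 * r * sin ((u - v) / 2))\<^sup>2 = (2 * r * sin t)\<^sup>2" by (simp add: power_mult_distrib)
    also have "\<dots> = 1" unfolding r_def using t by simp
    finally show ?thesis using norm_ge_zero[of "P u - P v"] by (auto simp: power2_eq_1_iff)
  qed
  have PD: "P u \<bullet> D = 0" for u unfolding P_def using XD YD by (simp add: inner_add_left)
  have za: "dist a (z j) = 1" "dist b (z j) = 1" for j
  proof -
    have "(D - P u) \<bullet> (D - P u) = 1" "(- D - P u) \<bullet> (- D - P u) = 1" for u
      using PD[of u] Pn[of u] DD unfolding power2_norm_eq_inner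
      by (simp_all add: inner_diff_left inner_diff_right inner_commute)
    moreover have "a - z j = D - P ((2 * real j - real k) * t)" "b - z j = - D - P ((2 * real j - real k) * t)"
      unfolding am z_def by simp_all
    ultimately show "dist a (z j) = 1" "dist b (z j) = 1"
      unfolding dist_norm norm_eq_1 by simp_all
  qed
  have z0: "z 0 = 0"
    unfolding z_def P_def X_def Y_def using c0 e0 by (simp add: c_def[symmetric] e_def[symmetric])
  have zk: "z k = s"
    unfolding z_def P_def X_def Y_def using c0 e0
    by (simp add: c_def[symmetric] e_def[symmetric] flip: scaleR_left_distrib)
  have zz: "dist (z j) (z (Suc j)) = 1" for j
    unfolding z_def dist_norm by (simp, rule PP) (simp add: algebra_simps)
  define zs where "zs = map z [1..<k]"
  have "0 # zs @ [s] = map z [0..<Suc k]"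
    unfolding zs_def using k z0 zk by (simp add: upt_conv_Cons)
  then have "successively (\<lambda>x y. dist x y = 1) (0 # zs @ [s])"
    using successively_upt[of 0 "Suc k" "\<lambda>x y. dist x y = 1" z] zz by (simp only:)
  moreover have "zs \<noteq> []" unfolding zs_def using k by simp
  moreover have "\<forall>z\<in>set zs. dist a z = 1 \<and> dist b z = 1" unfolding zs_def using za by auto
  ultimately show ?thesis unfolding fan_pair_def using ab by blast
qed

lemma hinge_radius:
  assumes "a \<in> hinge s"
  shows "(norm (a - (1/2) *\<^sub>R s))\<^sup>2 = 1 - (norm s)\<^sup>2 / 4" "(a - (1/2) *\<^sub>R s) \<bullet> s = 0"
  using hinge_inner[OF assms] unfolding power2_norm_eq_inner
  by (simp_all add: inner_diff_left inner_diff_right inner_commute)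

lemma hinge_norm_le:
  assumes "a \<in> hinge s" shows "norm s \<le> 2"
  using norm_triangle_ineq[of a "s - a"] assms unfolding hinge_def by simp

text \<open>The circle is parametrised by the angle from \<open>X\<close>, the radius to
  \<open>a\<close>. The second direction \<open>Y\<close> is taken along the part of the radius to
  \<open>b\<close> orthogonal to \<open>X\<close>, so that \<open>b\<close> sits at an angle
  \<open>t\<close> with a nonnegative sine.\<close>

lemma hinge_path:
  assumes a: "a \<in> hinge s" "b \<in> hinge s" and s: "s \<noteq> 0" "norm s < 2"
  obtains \<gamma> t where "\<gamma> 0 = a" "\<gamma> t = b" "t \<ge> 0" "\<And>u. \<gamma> u \<in> hinge s" "continuous_on UNIV \<gamma>"
    "\<And>u v. dist (\<gamma> u) (\<gamma> v) = 2 * sqrt (1 - (norm s)\<^sup>2 / 4) * \<bar>sin ((u - v) / 2)\<bar>"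
proof -
  define h where "h = sqrt (1 - (norm s)\<^sup>2 / 4)"
  have s4: "(norm s)\<^sup>2 < 4" using s(2) power_strict_mono[of "norm s" 2 2] by simp
  have h: "h > 0" "h\<^sup>2 = 1 - (norm s)\<^sup>2 / 4" unfolding h_def using s4 by simp_all
  define X where "X = a - (1/2) *\<^sub>R s"
  define d where "d = b - (1/2) *\<^sub>R s"
  have X: "X \<bullet> X = h\<^sup>2" "X \<bullet> s = 0" and d: "d \<bullet> d = h\<^sup>2" "d \<bullet> s = 0"
    using hinge_radius[OF a(1)] hinge_radius[OF a(2)] h unfolding X_def d_def power2_norm_eq_inner by auto
  define x where "x = (d \<bullet> X) / h\<^sup>2"
  define e where "e = d - x *\<^sub>R X"
  have eX: "e \<bullet> X = 0" "e \<bullet> s = 0" unfolding e_def x_def using X d h(1) by (simp_all add: inner_diff_left)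
  have ee: "e \<bullet> e = h\<^sup>2 * (1 - x\<^sup>2)"
  proof -
    have "e \<bullet> e = d \<bullet> d - 2 * x * (d \<bullet> X) + x\<^sup>2 * (X \<bullet> X)"
      unfolding e_def by (simp add: inner_diff_left inner_diff_right inner_commute power2_eq_square algebra_simps)
    also have "d \<bullet> X = x * h\<^sup>2" unfolding x_def using h(1) by simp
    finally show ?thesis using X d by (simp add: power2_eq_square algebra_simps)
  qed
  have "h\<^sup>2 * (1 - x\<^sup>2) \<ge> 0" using ee inner_ge_zero[of e] by simp
  then have x1: "1 - x\<^sup>2 \<ge> 0" using h(1) by (simp add: zero_le_mult_iff)
  define y where "y = sqrt (1 - x\<^sup>2)"
  have xy: "x\<^sup>2 + y\<^sup>2 = 1" "y \<ge> 0" unfolding y_def using x1 by auto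
  \<comment> \<open>If \<open>b\<close> is \<open>a\<close> or the point opposite to it, the
    orthogonal part vanishes and a cross product supplies the second direction.\<close>
  obtain Y where Y: "Y \<bullet> Y = h\<^sup>2" "Y \<bullet> s = 0" "X \<bullet> Y = 0" "e = y *\<^sub>R Y"
  proof (cases "y = 0")
    case True
    then have "e = 0" using ee xy by simp
    define W where "W = (1 / norm s) *\<^sub>R (cross3 X s)"
    have "(norm (cross3 X s))\<^sup>2 = h\<^sup>2 * (norm s)\<^sup>2"
      using norm_cross_dot[of X s] X by (simp add: power_mult_distrib power2_norm_eq_inner)
    then have "(cross3 X s) \<bullet> (cross3 X s) = h\<^sup>2 * (norm s)\<^sup>2" by (simp add: power2_norm_eq_inner)
    then have "W \<bullet> W = h\<^sup>2" unfolding W_def using s(1) by (simp add: power2_eq_square field_simps)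
    moreover have "W \<bullet> s = 0" "X \<bullet> W = 0" unfolding W_def by (simp_all add: dot_cross_self)
    ultimately show thesis using that \<open>e = 0\<close> True by simp
  next
    case False
    show thesis
    proof (rule that[of "(1/y) *\<^sub>R e"])
      have "1 - x\<^sup>2 = y * y" using xy by (simp add: power2_eq_square)
      then show "(1/y) *\<^sub>R e \<bullet> (1/y) *\<^sub>R e = h\<^sup>2" using ee False by simp
    qed (use eX False in \<open>auto simp: inner_commute\<close>)
  qed
  obtain t where t: "0 \<le> t" "x = cos t" "y = sin t" using sincos_total_2pi[OF xy(1)] by metis
  define \<gamma> where "\<gamma> u = (1/2) *\<^sub>R s + (cos u *\<^sub>R X + sin u *\<^sub>R Y)" for u
  have norms: "(norm X)\<^sup>2 = h\<^sup>2 * 1\<^sup>2" "(norm Y)\<^sup>2 = h\<^sup>2 * 1\<^sup>2" using X Y by (simp_all add: power2_norm_eq_inner)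
  note circ = dist_circle_points[OF Y(3) norms, simplified]
  show thesis
  proof (rule that[of \<gamma> t])
    show "\<gamma> 0 = a" unfolding \<gamma>_def X_def by simp
    show "\<gamma> t = b" unfolding \<gamma>_def t(2,3)[symmetric] Y(4)[symmetric] e_def d_def by simp
    show "\<gamma> u \<in> hinge s" for u
    proof (rule hingeI)
      define Q where "Q = cos u *\<^sub>R X + sin u *\<^sub>R Y"
      have Q: "Q \<bullet> Q = h\<^sup>2" "s \<bullet> Q = 0"
        unfolding Q_def using circ(1)[of u] X Y
        by (simp_all add: power2_norm_eq_inner inner_add_right inner_commute)
      have "\<gamma> u = (1/2) *\<^sub>R s + Q" unfolding \<gamma>_def Q_def ..
      then show "\<gamma> u \<bullet> \<gamma> u = 1" "s \<bullet> \<gamma> u = s \<bullet> s / 2" using Q h(2)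
        by (simp_all add: inner_add_left inner_add_right inner_commute power2_norm_eq_inner)
    qed
    show "continuous_on UNIV \<gamma>" unfolding \<gamma>_def by (intro continuous_intros)
    show "dist (\<gamma> u) (\<gamma> v) = 2 * sqrt (1 - (norm s)\<^sup>2 / 4) * \<bar>sin ((u - v) / 2)\<bar>" for u v
    proof -
      have "(dist (\<gamma> u) (\<gamma> v))\<^sup>2 = (2 * h * sin ((u - v) / 2))\<^sup>2"
        using circ(2)[of u v] unfolding \<gamma>_def dist_norm by simp
      then have "\<bar>dist (\<gamma> u) (\<gamma> v)\<bar> = \<bar>2 * h * sin ((u - v) / 2)\<bar>"
        by (simp only: power2_eq_iff abs_eq_iff)
      then show ?thesis using h(1) unfolding h_def[symmetric] by (simp add: abs_mult)
    qed
  qed (use t in auto)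
qed

text \<open>Here \<open>norm s\<close> is exactly 2 and the circle has shrunk to its centre.\<close>

lemma hinge_unique:
  assumes "a \<in> hinge s" "b \<in> hinge s" "\<not> norm s < 2"
  shows "a = b"
proof -
  have "norm s = 2" using assms hinge_norm_le by fastforce
  then have "(norm (a - (1/2) *\<^sub>R s))\<^sup>2 = 0" "(norm (b - (1/2) *\<^sub>R s))\<^sup>2 = 0"
    using hinge_radius(1)[OF assms(1)] hinge_radius(1)[OF assms(2)] by auto
  then show ?thesis by simp
qed

lemma hinge_IVT:
  assumes "a \<in> hinge s" "b \<in> hinge s" "s \<noteq> 0" "w \<bullet> b \<le> c" "c \<le> w \<bullet> a"
  obtains e where "e \<in> hinge s" "w \<bullet> e = c"
proof (cases "norm s < 2")
  case True
  obtain \<gamma> t where g: "\<gamma> 0 = a" "\<gamma> t = b" "t \<ge> 0" "\<And>u. \<gamma> u \<in> hinge s" "continuous_on UNIV \<gamma>"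
    "\<And>u v. dist (\<gamma> u) (\<gamma> v) = 2 * sqrt (1 - (norm s)\<^sup>2 / 4) * \<bar>sin ((u - v) / 2)\<bar>"
    using that by (rule hinge_path[OF assms(1-3) True])
  have "\<exists>u\<ge>0. u \<le> t \<and> w \<bullet> \<gamma> u = c"
  proof (rule IVT2')
    show "continuous_on {0..t} (\<lambda>u. w \<bullet> \<gamma> u)"
      by (intro continuous_on_inner continuous_on_const continuous_on_subset[OF g(5)]) simp
  qed (use g assms in auto)
  then show thesis using that g(4) by blast
next
  case False
  then show thesis using hinge_unique[OF assms(1,2)] that assms by force
qed

text \<open>Points at a fixed angle \<beta> with a chord shorter than \<epsilon> form a
  \<open>fan_pair\<close>. Repeating this turn from \<open>a\<close> and stopping just before
  passing \<open>b\<close> leaves an arc below \<beta>.\<close>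

lemma fan_dense:
  assumes a: "a \<in> hinge s" "b \<in> hinge s" and s: "s \<noteq> 0" "norm s < 2" and \<epsilon>: "\<epsilon> > 0"
  obtains e where "e \<in> hinge s" "dist e b < \<epsilon>" "(fan_pair s)\<^sup>*\<^sup>* a e"
proof -
  obtain \<gamma> t where g: "\<gamma> 0 = a" "\<gamma> t = b" "t \<ge> 0" "\<And>u. \<gamma> u \<in> hinge s"
    "\<And>u v. dist (\<gamma> u) (\<gamma> v) = 2 * sqrt (1 - (norm s)\<^sup>2 / 4) * \<bar>sin ((u - v) / 2)\<bar>"
    using hinge_path[OF a s] by metis
  define h where "h = sqrt (1 - (norm s)\<^sup>2 / 4)"
  have s4: "(norm s)\<^sup>2 < 4" using s(2) power_strict_mono[of "norm s" 2 2] by simp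
  have h: "h > 0" unfolding h_def using s4 by simp
  \<comment> \<open>Squared, because \<open>fan_angle\<close> controls the square of the chord; the
    bound by the diameter \<open>2 * h\<close> ensures that the chord fits into the circle.\<close>
  define \<delta> where "\<delta> = (min \<epsilon> (2 * h))\<^sup>2"
  have "norm s > 0" "\<delta> > 0" using s \<epsilon> h unfolding \<delta>_def by auto
  then obtain k \<theta> where k: "k \<ge> (2::nat)" "sin \<theta> > 1/2" "sin (real k * \<theta>) = norm s * sin \<theta>"
    "norm s * sin \<theta> < 1" "4 - 1 / (sin \<theta>)\<^sup>2 < \<delta>"
    using fan_angle[of "norm s" \<delta>] s(2) by metis
  define c where "c = sqrt (4 - 1 / (sin \<theta>)\<^sup>2)"
  have "1 / (sin \<theta>)\<^sup>2 < 4"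
  proof -
    have "(1/2)\<^sup>2 < (sin \<theta>)\<^sup>2" using k(2) by (intro power_strict_mono) auto
    then show ?thesis by (simp add: field_simps power2_eq_square)
  qed
  then have c: "c > 0" "c\<^sup>2 = 4 - 1 / (sin \<theta>)\<^sup>2" unfolding c_def by auto
  have "c < min \<epsilon> (2 * h)"
  proof (rule power2_less_imp_less)
    show "c\<^sup>2 < (min \<epsilon> (2 * h))\<^sup>2" using c(2) k(5) unfolding \<delta>_def by simp
  qed (use \<epsilon> h in auto)
  then have c\<epsilon>: "c < \<epsilon>" "c < 2 * h" by auto
  define \<beta> where "\<beta> = 2 * arcsin (c / (2 * h))"
  have ch: "0 < c / (2 * h)" "c / (2 * h) < 1" using c c\<epsilon> h by auto
  have \<beta>: "0 < \<beta>" "\<beta> < pi" "sin (\<beta> / 2) = c / (2 * h)"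
  proof -
    show "0 < \<beta>" unfolding \<beta>_def using arcsin_less_mono[of 0 "c / (2 * h)"] ch by simp
    have "\<bar>c / (2 * h)\<bar> \<le> 1" using ch by linarith
    then have "arcsin (c / (2 * h)) < pi / 2"
      using arcsin_less_mono[of "c / (2 * h)" 1] ch by simp
    then show "\<beta> < pi" unfolding \<beta>_def by simp
    show "sin (\<beta> / 2) = c / (2 * h)" unfolding \<beta>_def using ch by simp
  qed
  have step: "fan_pair s (\<gamma> (real j * \<beta>)) (\<gamma> (real (Suc j) * \<beta>))" for j
  proof (rule fan_pairI[OF g(4) g(4) s(1) k(1) _ k(3,4)])
    have "(real j * \<beta> - real (Suc j) * \<beta>) / 2 = - (\<beta> / 2)" by (simp add: algebra_simps)
    then have "dist (\<gamma> (real j * \<beta>)) (\<gamma> (real (Suc j) * \<beta>)) = 2 * h * \<bar>sin (\<beta> / 2)\<bar>"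
      using g(5)[of "real j * \<beta>" "real (Suc j) * \<beta>"] unfolding h_def by simp
    also have "\<dots> = c" unfolding \<beta>(3) using c(1) h by simp
    finally show "(dist (\<gamma> (real j * \<beta>)) (\<gamma> (real (Suc j) * \<beta>)))\<^sup>2 = 4 - 1 / (sin \<theta>)\<^sup>2" using c by simp
  qed (use k in auto)
  have reach: "(fan_pair s)\<^sup>*\<^sup>* a (\<gamma> (real j * \<beta>))" for j
  proof (induction j)
    case (Suc j)
    then show ?case using step[of j] by (rule rtranclp.rtrancl_into_rtrancl)
  qed (use g in simp)
  \<comment> \<open>The largest number of turns that does not go beyond the angle \<open>t\<close>
    of \<open>b\<close>.\<close>
  define j where "j = nat \<lfloor>t / \<beta>\<rfloor>"
  have "real j = of_int \<lfloor>t / \<beta>\<rfloor>" unfolding j_def using g(3) \<beta>(1) by simp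
  then have "real j \<le> t / \<beta>" "t / \<beta> < real j + 1" by linarith+
  then have tj: "0 \<le> t - real j * \<beta>" "t - real j * \<beta> < \<beta>" using \<beta>(1) by (simp_all add: field_simps)
  have "dist (\<gamma> (real j * \<beta>)) b = dist (\<gamma> t) (\<gamma> (real j * \<beta>))" using g(2) by (simp add: dist_commute)
  also have "\<dots> = 2 * h * \<bar>sin ((t - real j * \<beta>) / 2)\<bar>" using g(5) unfolding h_def by simp
  also have "\<bar>sin ((t - real j * \<beta>) / 2)\<bar> \<le> sin (\<beta> / 2)"
  proof -
    have "sin ((t - real j * \<beta>) / 2) \<ge> 0" using tj \<beta> by (intro sin_ge_zero) auto
    moreover have "sin ((t - real j * \<beta>) / 2) \<le> sin (\<beta> / 2)"
      using tj \<beta> by (intro sin_monotone_2pi_le) auto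
    ultimately show ?thesis by simp
  qed
  finally have "dist (\<gamma> (real j * \<beta>)) b \<le> c" using h \<beta>(3) by simp
  then show thesis using that[OF g(4) _ reach, of j] c\<epsilon> by linarith
qed

text \<open>Domed approximations of a curve have a slightly different sum \<open>r\<close> of the
  two edges, so a target on the circle of \<open>s\<close> needs a neighbour on the circle of
  \<open>r\<close>. The map \<phi> projects \<open>d\<close> to the plane orthogonal to
  \<open>r\<close> and rescales it to the new radius. It is continuous at \<open>s\<close> and takes
  \<open>s\<close> to \<open>a\<close>, since \<open>s\<close> is nonzero and
  \<open>norm s < 2\<close> makes \<open>d\<close> nonzero.\<close>

lemma hinge_lift:
  assumes a: "a \<in> hinge s" and s: "s \<noteq> 0" "norm s < 2" and \<epsilon>: "\<epsilon> > 0"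
  obtains \<delta> where "\<delta> > 0"
    "\<And>r. dist r s < \<delta> \<Longrightarrow> r \<noteq> 0 \<and> norm r < 2 \<and> (\<exists>b\<in>hinge r. dist b a < \<epsilon>)"
proof -
  define d where "d = a - (1/2) *\<^sub>R s"
  define P where "P r = d - ((d \<bullet> r) / (r \<bullet> r)) *\<^sub>R r" for r
  define \<phi> where "\<phi> r = (1/2) *\<^sub>R r + (sqrt (1 - (norm r)\<^sup>2 / 4) / norm (P r)) *\<^sub>R P r" for r
  have s4: "(norm s)\<^sup>2 < 4" using s(2) power_strict_mono[of "norm s" 2 2] by simp
  have d: "(norm d)\<^sup>2 = 1 - (norm s)\<^sup>2 / 4" "d \<bullet> s = 0"
    using hinge_radius[OF a] unfolding d_def by auto
  have d0: "norm d = sqrt (1 - (norm s)\<^sup>2 / 4)" "d \<noteq> 0"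
    using d s4 by (auto simp: real_sqrt_unique)
  have Ps: "P s = d" unfolding P_def using d by simp
  have \<phi>s: "\<phi> s = a"
  proof -
    have "\<phi> s = (1/2) *\<^sub>R s + d" unfolding \<phi>_def Ps d0(1)[symmetric] using d0(2) by simp
    then show ?thesis unfolding d_def by simp
  qed
  have contP: "isCont P s" unfolding P_def using s by (intro continuous_intros) auto
  have cont: "isCont \<phi> s" unfolding \<phi>_def
    using s Ps d0 contP by (intro continuous_intros) auto
  have "(\<phi> \<longlongrightarrow> \<phi> s) (nhds s)" "(P \<longlongrightarrow> P s) (nhds s)"
    using cont contP unfolding continuous_at tendsto_at_iff_tendsto_nhds .
  then have lim: "(\<phi> \<longlongrightarrow> a) (nhds s)" "(P \<longlongrightarrow> d) (nhds s)"
    unfolding \<phi>s Ps .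
  have "\<forall>\<^sub>F r in nhds s. dist (\<phi> r) a < \<epsilon>"
    using lim(1) \<epsilon> by (rule tendstoD)
  moreover have "\<forall>\<^sub>F r in nhds s. P r \<noteq> 0"
    using lim(2) d0(2) by (rule tendsto_imp_eventually_ne)
  moreover have "\<forall>\<^sub>F r in nhds s. r \<noteq> 0"
    using s(1) t1_space_nhds by blast
  moreover have "\<forall>\<^sub>F r in nhds s. norm r < 2"
    using s(2) by (intro order_tendstoD(2)[of norm "norm s"] tendsto_norm filterlim_ident)
  ultimately have "\<forall>\<^sub>F r in nhds s. r \<noteq> 0 \<and> norm r < 2 \<and> (\<exists>b\<in>hinge r. dist b a < \<epsilon>)"
  proof eventually_elim
    case (elim r)
    have r4: "(norm r)\<^sup>2 < 4" using elim power_strict_mono[of "norm r" 2 2] by simp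
    have Pr: "r \<bullet> P r = 0" unfolding P_def using elim by (simp add: inner_diff_right inner_commute)
    define e where "e = (sqrt (1 - (norm r)\<^sup>2 / 4) / norm (P r)) *\<^sub>R P r"
    have "(norm e)\<^sup>2 = 1 - (norm r)\<^sup>2 / 4"
      unfolding e_def using elim r4 by simp
    then have e: "e \<bullet> e = 1 - (norm r)\<^sup>2 / 4" by (simp only: power2_norm_eq_inner)
    have "r \<bullet> e = 0" unfolding e_def using Pr by simp
    have "\<phi> r = (1/2) *\<^sub>R r + e" unfolding \<phi>_def e_def ..
    then have "\<phi> r \<in> hinge r" using e \<open>r \<bullet> e = 0\<close>
      by (intro hingeI) (simp_all add: inner_add_left inner_add_right inner_commute power2_norm_eq_inner)
    then show ?case using elim by blast
  qed
  then show thesis using that unfolding eventually_nhds_metric by blast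
qed

text \<open>The point of the circle farthest against \<open>w\<close> satisfies
  \<open>w \<bullet> e = - (norm s / 2) * \<tau> - h * q\<close>, where \<open>- \<tau>\<close> and
  \<open>q\<close> are the components of \<open>w\<close> along and across \<open>s\<close>. Both
  coefficients are at least 1/2, and \<open>\<tau> + q \<ge> 1\<close> because \<tau> and
  \<open>q\<close> are the legs of a right triangle with hypotenuse 1.\<close>

lemma hinge_far_point:
  assumes u: "u \<in> hinge s" and s: "1 \<le> norm s" "(norm s)\<^sup>2 \<le> 2" and w: "norm w = 1" "w \<bullet> s \<le> 0"
  obtains e where "e \<in> hinge s" "w \<bullet> e \<le> - 1/2"
proof -
  have s0: "s \<noteq> 0" "s \<bullet> s = (norm s)\<^sup>2" using s by (auto simp: power2_norm_eq_inner)
  define \<kappa> where "\<kappa> = (w \<bullet> s) / (s \<bullet> s)"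
  define p where "p = w - \<kappa> *\<^sub>R s"
  define q where "q = norm p"
  define \<tau> where "\<tau> = - (w \<bullet> s) / norm s"
  have ps: "p \<bullet> s = 0" unfolding p_def \<kappa>_def using s0 by (simp add: inner_diff_left)
  have wp: "w \<bullet> p = q\<^sup>2"
  proof -
    have "w = p + \<kappa> *\<^sub>R s" unfolding p_def by simp
    then have "w \<bullet> p = p \<bullet> p" using ps by (metis add.right_neutral inner_add_left inner_commute inner_scaleR_left mult_zero_right)
    then show ?thesis unfolding q_def by (simp add: power2_norm_eq_inner)
  qed
  have q2: "q\<^sup>2 = 1 - \<tau>\<^sup>2"
  proof -
    have "w \<bullet> p = 1 - (w \<bullet> s)\<^sup>2 / (s \<bullet> s)"
      unfolding p_def \<kappa>_def using w(1) by (simp add: inner_diff_right norm_eq_1 power2_eq_square)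
    then show ?thesis using wp s0 unfolding \<tau>_def by (simp add: power_divide)
  qed
  have \<tau>: "\<tau> \<ge> 0" unfolding \<tau>_def using w(2) by (intro divide_nonneg_nonneg) auto
  have q0: "q \<ge> 0" unfolding q_def by simp
  have ws: "w \<bullet> s = - \<tau> * norm s" unfolding \<tau>_def using s0 by simp
  have sum1: "\<tau> + q \<ge> 1"
  proof (rule power2_le_imp_le)
    show "1\<^sup>2 \<le> (\<tau> + q)\<^sup>2" using q2 \<tau> q0 by (simp add: power2_sum)
  qed (use \<tau> q0 in auto)
  define h where "h = sqrt (1 - (norm s)\<^sup>2 / 4)"
  have h2: "h\<^sup>2 = 1 - (norm s)\<^sup>2 / 4" unfolding h_def using s by simp
  have h: "h \<ge> 1/2" using s h2 unfolding h_def by (intro real_le_rsqrt) (simp add: power2_eq_square)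
  show thesis
  proof (cases "q = 0")
    case True
    \<comment> \<open>Now \<open>w\<close> is antiparallel to \<open>s\<close>, all points of the
      circle have the same product with it, and \<open>u\<close> serves as well as any.\<close>
    then have p0: "w = \<kappa> *\<^sub>R s" unfolding q_def p_def by simp
    have "w \<bullet> u = \<kappa> * (s \<bullet> u)" using p0 by simp
    also have "\<dots> = (w \<bullet> s) / 2" unfolding hinge_inner(2)[OF u] \<kappa>_def using s0(1) by simp
    also have "\<dots> \<le> - 1/2"
    proof -
      have "\<tau> \<ge> 1" using sum1 True by simp
      then have "\<tau> * norm s \<ge> 1 * 1" using s by (intro mult_mono) auto
      then show ?thesis unfolding ws by simp
    qed
    finally show thesis using that u by blast
  next
    case False
    define e where "e = (1/2) *\<^sub>R s - (h / q) *\<^sub>R p"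
    have "(h / q) *\<^sub>R p \<bullet> (h / q) *\<^sub>R p = h\<^sup>2"
      using False unfolding q_def by (simp add: dot_square_norm power2_eq_square)
    then have "e \<in> hinge s" unfolding e_def using ps h2 s0
      by (intro hingeI) (simp_all add: inner_diff_left inner_diff_right inner_commute)
    moreover have "w \<bullet> e = - (norm s / 2) * \<tau> - h * q"
      unfolding e_def using wp ws False by (simp add: inner_diff_right power2_eq_square)
    moreover have "(norm s / 2) * \<tau> \<ge> (1/2) * \<tau>" "h * q \<ge> (1/2) * q"
      using s h \<tau> q0 by (intro mult_right_mono; simp)+
    ultimately show thesis using that[of e] sum1 by simp
  qed
qed

section \<open>Curves as lists of edge vectors\<close>

fun polyline :: "point3 \<Rightarrow> point3 list \<Rightarrow> point3 list" where
  "polyline c [] = [c]"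
| "polyline c (u # us) = c # polyline (c + u) us"

lemma length_polyline [simp]: "length (polyline c us) = Suc (length us)"
  by (induction us arbitrary: c) auto

lemma polyline_not_Nil [simp]: "polyline c us \<noteq> []"
  by (cases us) auto

lemma polyline_nth: "i \<le> length us \<Longrightarrow> polyline c us ! i = c + sum_list (take i us)"
proof (induction us arbitrary: c i)
  case (Cons u us)
  then show ?case by (cases i) (auto simp: add.assoc)
qed simp

lemma polyline_append:
  "polyline c (xs @ ys) = butlast (polyline c xs) @ polyline (c + sum_list xs) ys"
  by (induction xs arbitrary: c) (auto simp: add.assoc)

lemma polyline_Cons_tl: "polyline c us = c # tl (polyline c us)"
  by (cases us) auto

text \<open>With a start point and edge vectors, each move replaces neighbouring entries by others
  with the same sum; all other vertices stay where they are.\<close>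

definition domed_steps :: "point3 \<Rightarrow> point3 list \<Rightarrow> bool" where
  "domed_steps c us \<longleftrightarrow> (\<forall>u\<in>set us. norm u = 1) \<and> (\<exists>T bs f. dome T bs f \<and> map f bs = polyline c us)"

lemma domed_steps_fan:
  assumes D: "domed_steps c (xs @ [a, b] @ ys)" and F: "fan_pair (a + b) a a'"
  shows "domed_steps c (xs @ [a', a + b - a'] @ ys)"
proof -
  obtain T bs f where d: "dome T bs f" and m: "map f bs = polyline c (xs @ [a, b] @ ys)"
    and unit: "\<forall>u\<in>set (xs @ [a, b] @ ys). norm u = 1"
    using D unfolding domed_steps_def by blast
  obtain zs where zs: "zs \<noteq> []" "\<forall>z\<in>set zs. dist a z = 1 \<and> dist a' z = 1"
      "successively (\<lambda>x y. dist x y = 1) (0 # zs @ [a + b])"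
    and a': "a' \<in> hinge (a + b)"
    using F unfolding fan_pair_def by blast
  define p where "p = c + sum_list xs"
  define tail where "tail = tl (polyline (p + a + b) ys)"
  \<comment> \<open>Any two edges \<open>x\<close>, \<open>y\<close> with sum \<open>a + b\<close>
    give the same polygon up to the single vertex \<open>p + x\<close>.\<close>
  have poly: "polyline c (xs @ [x, y] @ ys) = butlast (polyline c xs) @ [p, p + x, p + a + b] @ tail"
    if "x + y = a + b" for x y
  proof -
    have "p + (x + y) = p + a + b" using that by (simp add: add.assoc)
    then show ?thesis unfolding polyline_append p_def[symmetric] tail_def
      using polyline_Cons_tl[of "p + a + b" ys] by (simp add: add.assoc)
  qed
  have "map f bs = butlast (polyline c xs) @ [p, p + a, p + a + b] @ tail" unfolding m poly[OF refl] ..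
  then obtain B1 B2 i j k where bs: "bs = B1 @ [i, j, k] @ B2"
    and mB: "map f B1 = butlast (polyline c xs)" "map f B2 = tail"
    and fi: "f i = p" "f j = p + a" "f k = p + a + b"
    by (auto simp: map_eq_append_conv map_eq_Cons_conv)
  have "\<exists>T' x f'. dome T' (B1 @ [i, x, k] @ B2) f' \<and> f' x = p + a' \<and> x \<notin> \<Union>T \<and> (\<forall>u\<in>\<Union>T. f' u = f u)"
  proof (rule dome_fan)
    show "dome T (B1 @ [i, j, k] @ B2) f" using d bs by simp
    show "map ((+) p) zs \<noteq> []" using zs by simp
    show "dist (f j) z = 1" if "z \<in> set (map ((+) p) zs)" for z
      using that zs(2) fi by auto
    show "dist (p + a') z = 1" if "z \<in> set (map ((+) p) zs)" for z
      using that zs(2) by auto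
    have "f i # map ((+) p) zs @ [f k] = map ((+) p) (0 # zs @ [a + b])"
      using fi by (simp add: add.assoc)
    then show "successively (\<lambda>x y. dist x y = 1) (f i # map ((+) p) zs @ [f k])"
      using zs(3) by (simp only: successively_map dist_add_cancel)
    show "dist (f i) (p + a') = 1" using fi a' unfolding hinge_def dist_norm by simp
    show "dist (f k) (p + a') = 1" using fi a' unfolding hinge_def dist_norm by (simp add: add.assoc)
  qed
  then obtain T' x f' where d': "dome T' (B1 @ [i, x, k] @ B2) f'" and fx: "f' x = p + a'"
    and agree: "\<forall>u\<in>\<Union>T. f' u = f u" by (elim exE conjE)
  have V: "set bs \<subseteq> \<Union>T" by (rule dome_vertices[OF d])
  have eq: "f' u = f u" if "u \<in> set bs" for u using bspec[OF agree subsetD[OF V that]] .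
  have "map f' B1 = map f B1" "map f' B2 = map f B2" "f' i = f i" "f' k = f k"
    using eq unfolding bs by auto
  then have "map f' (B1 @ [i, x, k] @ B2) = polyline c (xs @ [a', a + b - a'] @ ys)"
    using poly[of a' "a + b - a'"] fx fi mB by simp
  moreover have "\<forall>u\<in>set (xs @ [a', a + b - a'] @ ys). norm u = 1"
    using unit a' unfolding hinge_def by auto
  ultimately show ?thesis unfolding domed_steps_def using d' by blast
qed

lemma domed_steps_fans:
  assumes "(fan_pair s)\<^sup>*\<^sup>* a e" "domed_steps c (xs @ [a, s - a] @ ys)"
  shows "domed_steps c (xs @ [e, s - e] @ ys)"
  using assms(1)
proof (induction rule: rtranclp_induct)
  case (step y z)
  then show ?case using domed_steps_fan[of c xs y "s - y" ys z] by simp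
qed (rule assms(2))

lemma domed_steps_ear:
  assumes D: "domed_steps c (xs @ [s] @ ys)" and a: "a \<in> hinge s"
  shows "domed_steps c (xs @ [a, s - a] @ ys)"
proof -
  obtain T bs f where d: "dome T bs f" and m: "map f bs = polyline c (xs @ [s] @ ys)"
    and unit: "\<forall>u\<in>set (xs @ [s] @ ys). norm u = 1"
    using D unfolding domed_steps_def by blast
  define p where "p = c + sum_list xs"
  define tail where "tail = tl (polyline (p + s) ys)"
  have poly: "polyline c (xs @ [s] @ ys) = butlast (polyline c xs) @ [p, p + s] @ tail"
    "polyline c (xs @ [a, s - a] @ ys) = butlast (polyline c xs) @ [p, p + a, p + s] @ tail"
    unfolding polyline_append p_def[symmetric] tail_def
    using polyline_Cons_tl[of "p + s" ys] by simp_all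
  then obtain B1 B2 i k where bs: "bs = B1 @ [i, k] @ B2"
    and mB: "map f B1 = butlast (polyline c xs)" "map f B2 = tail"
    and fi: "f i = p" "f k = p + s"
    using m by (auto simp: map_eq_append_conv map_eq_Cons_conv)
  obtain x where x: "x \<notin> \<Union>T" using fresh_vertex dome_surface[OF d] by blast
  have V: "set bs \<subseteq> \<Union>T" by (rule dome_vertices[OF d])
  define f' where "f' = f(x := p + a)"
  have "dome (insert {i, k, x} T) (B1 @ [i, x, k] @ B2) f'"
    unfolding f'_def
  proof (rule dome_add_ear[OF _ x])
    show "dome T (B1 @ [i, k] @ B2) f" using d bs by simp
    show "dist (f i) (p + a) = 1" using fi a unfolding hinge_def dist_norm by simp
    show "dist (f k) (p + a) = 1" using fi a unfolding hinge_def dist_norm by simp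
  qed
  moreover have "x \<notin> set bs" using x V by blast
  then have "map f' (B1 @ [i, x, k] @ B2) = polyline c (xs @ [a, s - a] @ ys)"
    unfolding poly(2) using mB fi unfolding bs f'_def by (auto simp: map_eq_conv)
  moreover have "\<forall>u\<in>set (xs @ [a, s - a] @ ys). norm u = 1"
    using unit a unfolding hinge_def by auto
  ultimately show ?thesis unfolding domed_steps_def by blast
qed

lemma domed_steps_triangle:
  assumes "norm a = 1" "norm b = 1" "norm d = 1" "a + b + d = 0"
  shows "domed_steps c [a, b, d]"
proof -
  define f where "f i = (if i = 0 then c else if i = 1 then c + a else c + a + b)" for i :: nat
  have d: "d = - (a + b)" using assms(4) by (rule minus_unique[symmetric])
  have "dome {{0, 1, 2}} [0, 1, 2, 0] f"
  proof (rule dome_single_triangle)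
    show "dist (f 0) (f 1) = 1" "dist (f 1) (f 2) = 1" using assms unfolding f_def dist_norm by simp_all
    have "norm (a + b) = 1" using assms(3) unfolding d by (metis norm_minus_cancel)
    then have "dist c (c + (a + b)) = 1" by (simp add: dist_norm flip: norm_minus_cancel[of "a + b"])
    then show "dist (f 0) (f 2) = 1" unfolding f_def by (simp add: add.assoc)
  qed
  moreover have "map f [0, 1, 2, 0] = polyline c [a, b, d]"
    unfolding f_def d by simp
  moreover have "\<forall>u\<in>set [a, b, d]. norm u = 1" using assms by simp
  ultimately show ?thesis unfolding domed_steps_def by blast
qed

section \<open>The closure of the set of domed curves\<close>

definition approx_domed :: "point3 \<Rightarrow> point3 list \<Rightarrow> bool" where
  "approx_domed c us \<longleftrightarrow>
     (\<forall>\<epsilon>>0. \<exists>ws. list_all2 (\<lambda>x y. dist x y < \<epsilon>) us ws \<and> domed_steps c ws)"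

text \<open>A closure is closed; this lets an exceptional curve be treated through nearby
  ones.\<close>

lemma approx_domed_limit:
  assumes "\<And>\<epsilon>. \<epsilon> > 0 \<Longrightarrow> \<exists>ws. list_all2 (\<lambda>x y. dist x y < \<epsilon>) us ws \<and> approx_domed c ws"
  shows "approx_domed c us"
  unfolding approx_domed_def
proof (intro allI impI)
  fix \<epsilon> :: real assume "\<epsilon> > 0"
  then have e2: "\<epsilon>/2 > 0" by simp
  obtain ws where ws: "list_all2 (\<lambda>x y. dist x y < \<epsilon>/2) us ws" "approx_domed c ws"
    using assms[OF e2] by blast
  obtain vs where vs: "list_all2 (\<lambda>x y. dist x y < \<epsilon>/2) ws vs" "domed_steps c vs"
    using ws(2) e2 unfolding approx_domed_def by blast
  have "list_all2 (\<lambda>x y. dist x y < \<epsilon>) us vs"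
  proof (rule list_all2_trans[OF _ ws(1) vs(1)])
    show "dist x z < \<epsilon>" if "dist x y < \<epsilon>/2" "dist y z < \<epsilon>/2" for x y z :: point3
      using dist_triangle_half_l[of x y \<epsilon> z] that by (simp add: dist_commute)
  qed
  then show "\<exists>ws. list_all2 (\<lambda>x y. dist x y < \<epsilon>) us ws \<and> domed_steps c ws" using vs(2) by blast
qed

lemma list_all2_appendE:
  assumes "list_all2 P (xs @ ys @ zs) ws"
  obtains xs' ys' zs' where "ws = xs' @ ys' @ zs'" "list_all2 P xs xs'" "list_all2 P ys ys'" "list_all2 P zs zs'"
  using assms by (auto simp: list_all2_append1)

lemma list_all2_dist_mono:
  "list_all2 (\<lambda>x y. dist x y < d) xs ys \<Longrightarrow> d \<le> e \<Longrightarrow> list_all2 (\<lambda>x y. dist x y < e) xs ys"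
  by (erule list_all2_mono) simp

lemma hinge_reflect: "a \<in> hinge s \<Longrightarrow> s - a \<in> hinge s"
  unfolding hinge_def by simp

text \<open>In a domed curve close to the given one, the two edges are some \<open>p\<close>,
  \<open>q\<close> with sum \<open>r\<close> near \<open>s\<close>. \<open>hinge_lift\<close>
  carries the target \<open>a\<close> to a point \<open>b'\<close> on the circle of
  \<open>r\<close>, and \<open>fan_dense\<close> moves \<open>p\<close> close to
  \<open>b'\<close>.\<close>

lemma approx_domed_flip:
  assumes a: "a \<in> hinge s" and b: "b \<in> hinge s" and s: "s \<noteq> 0"
    and A: "approx_domed c (xs @ [b, s - b] @ ys)"
  shows "approx_domed c (xs @ [a, s - a] @ ys)"
proof (cases "norm s < 2")
  case False
  then show ?thesis using hinge_unique[OF a b] A by simp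
next
  case True
  show ?thesis unfolding approx_domed_def
  proof (intro allI impI)
    fix \<epsilon> :: real assume "\<epsilon> > 0"
    then have e4: "\<epsilon>/4 > 0" by simp
    obtain \<delta> where \<delta>: "\<delta> > 0"
      "\<And>r. dist r s < \<delta> \<Longrightarrow> r \<noteq> 0 \<and> norm r < 2 \<and> (\<exists>b\<in>hinge r. dist b a < \<epsilon>/4)"
      using hinge_lift[OF a s True e4] by blast
    \<comment> \<open>The errors of \<open>p\<close> and \<open>q\<close> add up in
      \<open>r\<close>, so \<eta> is at most half of \<delta>.\<close>
    define \<eta> where "\<eta> = min (\<delta>/2) (\<epsilon>/4)"
    have \<eta>: "\<eta> > 0" "2 * \<eta> \<le> \<delta>" "\<eta> \<le> \<epsilon>/4" unfolding \<eta>_def using \<delta> e4 by auto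
    obtain ws where ws: "list_all2 (\<lambda>x y. dist x y < \<eta>) (xs @ [b, s - b] @ ys) ws" "domed_steps c ws"
      using A \<eta>(1) unfolding approx_domed_def by blast
    obtain xs' pq ys' where split: "ws = xs' @ pq @ ys'" "list_all2 (\<lambda>x y. dist x y < \<eta>) xs xs'"
      "list_all2 (\<lambda>x y. dist x y < \<eta>) [b, s - b] pq" "list_all2 (\<lambda>x y. dist x y < \<eta>) ys ys'"
      using ws(1) by (rule list_all2_appendE)
    obtain p q where pq: "pq = [p, q]" "dist b p < \<eta>" "dist (s - b) q < \<eta>"
      using split(3) by (auto simp: list_all2_Cons1)
    define r where "r = p + q"
    have rs: "dist r s < 2 * \<eta>"
    proof -
      have "dist r s = norm ((p - b) + (q - (s - b)))" unfolding r_def dist_norm by (simp add: algebra_simps)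
      also have "\<dots> \<le> norm (p - b) + norm (q - (s - b))" by (rule norm_triangle_ineq)
      finally show ?thesis using pq(2,3) by (simp add: dist_norm norm_minus_commute)
    qed
    then have "dist r s < \<delta>" using \<eta> by simp
    then obtain b' where r: "r \<noteq> 0" "norm r < 2" and b': "b' \<in> hinge r" "dist b' a < \<epsilon>/4"
      using \<delta>(2) by blast
    have "norm p = 1" "norm q = 1"
      using ws(2) unfolding domed_steps_def split(1) pq(1) by auto
    then have p: "p \<in> hinge r" unfolding hinge_def r_def by simp
    obtain e where e: "e \<in> hinge r" "dist e b' < \<epsilon>/4" "(fan_pair r)\<^sup>*\<^sup>* p e"
      using fan_dense[OF p b'(1) r e4] by blast
    have "domed_steps c (xs' @ [e, r - e] @ ys')"
      by (rule domed_steps_fans[OF e(3)]) (use ws(2) split(1) pq(1) in \<open>simp add: r_def\<close>)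
    moreover have ae: "dist a e < \<epsilon>/2"
      using dist_triangle[of a e b'] b'(2) e(2) by (simp add: dist_commute)
    have "dist (s - a) (r - e) \<le> dist s r + dist a e"
      using norm_triangle_ineq4[of "s - r" "a - e"] unfolding dist_norm by (simp add: algebra_simps)
    then have "dist (s - a) (r - e) < \<epsilon>" using rs ae \<eta> by (simp add: dist_commute)
    then have "list_all2 (\<lambda>x y. dist x y < \<epsilon>) (xs @ [a, s - a] @ ys) (xs' @ [e, r - e] @ ys')"
      using list_all2_dist_mono[OF split(2), of \<epsilon>] list_all2_dist_mono[OF split(4), of \<epsilon>] ae \<eta> e4
      by (intro list_all2_appendI) auto
    ultimately show "\<exists>ws. list_all2 (\<lambda>x y. dist x y < \<epsilon>) (xs @ [a, s - a] @ ys) ws \<and> domed_steps c ws"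
      by blast
  qed
qed

text \<open>As for the flip, except that the edge \<open>r\<close> near \<open>s\<close> receives an
  ear, with its apex placed by \<open>hinge_lift\<close>.\<close>

lemma approx_domed_ear:
  assumes a: "a \<in> hinge s" and s: "norm s = 1" and A: "approx_domed c (xs @ [s] @ ys)"
  shows "approx_domed c (xs @ [a, s - a] @ ys)"
  unfolding approx_domed_def
proof (intro allI impI)
  fix \<epsilon> :: real assume "\<epsilon> > 0"
  then have e4: "\<epsilon>/4 > 0" by simp
  have s0: "s \<noteq> 0" "norm s < 2" using s by auto
  obtain \<delta> where \<delta>: "\<delta> > 0"
    "\<And>r. dist r s < \<delta> \<Longrightarrow> r \<noteq> 0 \<and> norm r < 2 \<and> (\<exists>b\<in>hinge r. dist b a < \<epsilon>/4)"
    using hinge_lift[OF a s0 e4] by blast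
  define \<eta> where "\<eta> = min \<delta> (\<epsilon>/4)"
  have \<eta>: "\<eta> > 0" "\<eta> \<le> \<delta>" "\<eta> \<le> \<epsilon>/4" unfolding \<eta>_def using \<delta> e4 by auto
  obtain ws where ws: "list_all2 (\<lambda>x y. dist x y < \<eta>) (xs @ [s] @ ys) ws" "domed_steps c ws"
    using A \<eta>(1) unfolding approx_domed_def by blast
  obtain xs' rr ys' where split: "ws = xs' @ rr @ ys'" "list_all2 (\<lambda>x y. dist x y < \<eta>) xs xs'"
    "list_all2 (\<lambda>x y. dist x y < \<eta>) [s] rr" "list_all2 (\<lambda>x y. dist x y < \<eta>) ys ys'"
    using ws(1) by (rule list_all2_appendE)
  obtain r where r: "rr = [r]" "dist s r < \<eta>" using split(3) by (auto simp: list_all2_Cons1)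
  obtain e where e: "e \<in> hinge r" "dist e a < \<epsilon>/4" using \<delta>(2)[of r] r(2) \<eta>(2) by (auto simp: dist_commute)
  have "domed_steps c (xs' @ [e, r - e] @ ys')"
    by (rule domed_steps_ear[OF _ e(1)]) (use ws(2) split(1) r(1) in simp)
  moreover have "dist (s - a) (r - e) \<le> dist s r + dist a e"
    using norm_triangle_ineq4[of "s - r" "a - e"] unfolding dist_norm by (simp add: algebra_simps)
  then have "dist (s - a) (r - e) < \<epsilon>" using r(2) e(2) \<eta> by (simp add: dist_commute)
  then have "list_all2 (\<lambda>x y. dist x y < \<epsilon>) (xs @ [a, s - a] @ ys) (xs' @ [e, r - e] @ ys')"
    using list_all2_dist_mono[OF split(2), of \<epsilon>] list_all2_dist_mono[OF split(4), of \<epsilon>] e(2) \<eta> e4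
    by (intro list_all2_appendI) (auto simp: dist_commute)
  ultimately show "\<exists>ws. list_all2 (\<lambda>x y. dist x y < \<epsilon>) (xs @ [a, s - a] @ ys) ws \<and> domed_steps c ws"
    by blast
qed

definition closed_steps :: "nat \<Rightarrow> point3 list \<Rightarrow> bool" where
  "closed_steps n us \<longleftrightarrow> length us = n \<and> (\<forall>u\<in>set us. norm u = 1) \<and> sum_list us = 0"

lemma closed_steps_mset: "mset us = mset vs \<Longrightarrow> closed_steps n us \<longleftrightarrow> closed_steps n vs"
  unfolding closed_steps_def by (metis mset_eq_length mset_eq_setD sum_mset_sum_list)

text \<open>For \<open>w\<close> equal to \<open>y\<close> or \<open>- y\<close>, a slight rotation
  of \<open>y\<close> towards an orthogonal \<open>z\<close> works, since \<open>w\<close> is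
  orthogonal to \<open>z\<close> and the rotated vector is not.\<close>

lemma sphere_perturb:
  fixes y w :: point3
  assumes "norm y = 1" "norm w = 1" "\<epsilon> > 0"
  obtains y' where "norm y' = 1" "dist y y' < \<epsilon>" "w \<noteq> y'" "w \<noteq> - y'"
proof (cases "w = y \<or> w = - y")
  case False
  then show thesis using that[of y] assms by auto
next
  case True
  obtain z0 :: point3 where z0: "z0 \<noteq> 0" "orthogonal y z0"
    using orthogonal_to_vector_exists[of y] by auto
  define z where "z = (1 / norm z0) *\<^sub>R z0"
  have z: "z \<bullet> z = 1" "y \<bullet> z = 0" "y \<bullet> y = 1"
    using z0 assms unfolding z_def orthogonal_def by (auto simp: dot_square_norm power2_eq_square norm_eq_1)
  define g where "g t = cos t *\<^sub>R y + sin t *\<^sub>R z" for t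
  have "(g \<longlongrightarrow> g 0) (at_right 0)" unfolding g_def by (intro tendsto_intros)
  then have "\<forall>\<^sub>F t in at_right 0. dist (g t) (g 0) < \<epsilon>" using assms(3) by (rule tendstoD)
  moreover have "\<forall>\<^sub>F t::real in at_right 0. 0 < t \<and> t < pi"
    using eventually_at_right_real[of 0 pi] by (rule eventually_mono) auto
  ultimately have "\<forall>\<^sub>F t in at_right 0. dist (g t) (g 0) < \<epsilon> \<and> 0 < t \<and> t < pi"
    by eventually_elim simp
  then obtain t where t: "dist (g t) (g 0) < \<epsilon>" "0 < t" "t < pi"
    using eventually_happens'[OF trivial_limit_at_right_real] by blast
  have gz: "g t \<bullet> z \<noteq> 0" unfolding g_def using z sin_gt_zero[OF t(2,3)] by (simp add: inner_add_left)
  have "g t \<bullet> g t = (cos t)\<^sup>2 + (sin t)\<^sup>2"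
    unfolding g_def using z by (simp add: inner_add_left inner_add_right inner_commute power2_eq_square)
  then have "norm (g t) = 1" by (simp add: norm_eq_1)
  moreover have "dist y (g t) < \<epsilon>" using t(1) by (simp add: g_def dist_commute)
  moreover have "w \<bullet> z = 0" using True z by auto
  then have "w \<noteq> g t" "w \<noteq> - g t" using gz by auto
  ultimately show thesis using that by blast
qed

section \<open>The inductive step from \<open>n\<close> to \<open>Suc n\<close> edges\<close>

context
  fixes n :: nat and c :: point3
  assumes n3: "n \<ge> 3" and IH: "\<And>us. closed_steps n us \<Longrightarrow> approx_domed c us"
begin

text \<open>Edges at this angle have a unit sum. With the sum in their place the curve has
  \<open>n\<close> edges, and an ear on it brings the two back.\<close>

lemma approx_domed_triangle_sides:
  assumes C: "closed_steps (Suc n) (xs @ [a, b] @ ys)" and ab: "a \<bullet> b = - 1/2"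
  shows "approx_domed c (xs @ [a, b] @ ys)"
proof -
  have n1: "norm a = 1" "norm b = 1" using C unfolding closed_steps_def by auto
  have "(a + b) \<bullet> (a + b) = 1"
    using n1 ab by (simp add: inner_add_left inner_add_right inner_commute norm_eq_1)
  then have s: "norm (a + b) = 1" by (simp add: norm_eq_1)
  have "closed_steps n (xs @ [a + b] @ ys)"
    using C s unfolding closed_steps_def by (auto simp: add.assoc)
  then have "approx_domed c (xs @ [a + b] @ ys)" by (rule IH)
  moreover have "a \<in> hinge (a + b)" unfolding hinge_def using n1 by simp
  ultimately show ?thesis using approx_domed_ear[of a "a + b" c xs ys] s by simp
qed

text \<open>After rotating the pair to \<open>a + b - e\<close>, \<open>e\<close>, the edge
  \<open>e\<close> stands next to \<open>w\<close> at the required angle; rotating back is a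
  flip.\<close>

lemma approx_domed_hinge_left:
  assumes C: "closed_steps (Suc n) (xs @ [a, b, w] @ ys)" and s: "a + b \<noteq> 0"
    and e: "e \<in> hinge (a + b)" "w \<bullet> e = - 1/2"
  shows "approx_domed c (xs @ [a, b, w] @ ys)"
proof -
  have n1: "norm a = 1" "norm b = 1" using C unfolding closed_steps_def by auto
  have "closed_steps (Suc n) ((xs @ [a + b - e]) @ [e, w] @ ys)"
    using C e(1) unfolding closed_steps_def hinge_def by (auto simp: algebra_simps)
  then have "approx_domed c ((xs @ [a + b - e]) @ [e, w] @ ys)"
    by (rule approx_domed_triangle_sides) (use e in \<open>simp add: inner_commute\<close>)
  moreover have "a \<in> hinge (a + b)" unfolding hinge_def using n1 by simp
  ultimately show ?thesis
    using approx_domed_flip[of a "a + b" "a + b - e" c xs "w # ys"] hinge_reflect[OF e(1)] s by simp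
qed

lemma approx_domed_hinge_right:
  assumes C: "closed_steps (Suc n) (xs @ [w, a, b] @ ys)" and s: "a + b \<noteq> 0"
    and e: "e \<in> hinge (a + b)" "w \<bullet> e = - 1/2"
  shows "approx_domed c (xs @ [w, a, b] @ ys)"
proof -
  have n1: "norm a = 1" "norm b = 1" using C unfolding closed_steps_def by auto
  have "closed_steps (Suc n) (xs @ [w, e] @ (a + b - e) # ys)"
    using C e(1) unfolding closed_steps_def hinge_def by (auto simp: algebra_simps)
  then have "approx_domed c (xs @ [w, e] @ (a + b - e) # ys)"
    by (rule approx_domed_triangle_sides) (use e in simp)
  moreover have "a \<in> hinge (a + b)" unfolding hinge_def using n1 by simp
  ultimately show ?thesis
    using approx_domed_flip[of a "a + b" e c "xs @ [w]" ys] e s by simp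
qed

text \<open>Rotating the pair \<open>w\<close>, \<open>- y\<close> takes the product with
  \<open>y\<close> from \<open>y \<bullet> w\<close> to -1; rotating \<open>y\<close>,
  \<open>w\<close> does the same for the product with \<open>- y\<close>. As the products of
  \<open>w\<close> with \<open>y\<close> and \<open>- y\<close> are not both below -1/2, one of the
  two rotations meets -1/2.\<close>

lemma approx_domed_antipodal_around:
  assumes C: "closed_steps (Suc n) (xs @ [y, w, - y] @ ys)" and ne: "w \<noteq> y" "w \<noteq> - y"
  shows "approx_domed c (xs @ [y, w, - y] @ ys)"
proof -
  have n1: "norm y = 1" "norm w = 1" using C unfolding closed_steps_def by auto
  then have yy: "y \<bullet> y = 1" by (simp add: norm_eq_1)
  show ?thesis
  proof (cases "y \<bullet> w \<ge> - 1/2")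
    case True
    have "w \<in> hinge (w + - y)" "- y \<in> hinge (w + - y)" unfolding hinge_def using n1 by auto
    moreover have "w + - y \<noteq> 0" using ne by simp
    ultimately obtain e where "e \<in> hinge (w + - y)" "y \<bullet> e = - 1/2"
      using hinge_IVT[of w "w + - y" "- y" y "- 1/2"] True yy by auto
    then show ?thesis using approx_domed_hinge_right[OF C \<open>w + - y \<noteq> 0\<close>] by blast
  next
    case False
    have "w \<in> hinge (y + w)" "y \<in> hinge (y + w)" unfolding hinge_def using n1 by auto
    moreover have "y + w \<noteq> 0" using ne by (metis add.inverse_unique)
    ultimately obtain e where "e \<in> hinge (y + w)" "(- y) \<bullet> e = - 1/2"
      using hinge_IVT[of w "y + w" y "- y" "- 1/2"] False yy by auto
    then show ?thesis using approx_domed_hinge_left[OF C \<open>y + w \<noteq> 0\<close>] by blast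
  qed
qed

text \<open>A transposition is the half turn of the pair about its sum.\<close>

lemma approx_domed_swap_neq:
  assumes C: "closed_steps m (xs @ [a, b] @ ys)" and A: "approx_domed c (xs @ [b, a] @ ys)" and "a + b \<noteq> 0"
  shows "approx_domed c (xs @ [a, b] @ ys)"
proof -
  have n1: "norm a = 1" "norm b = 1" using C unfolding closed_steps_def by auto
  then have "a \<in> hinge (a + b)" "b \<in> hinge (a + b)" unfolding hinge_def by auto
  then show ?thesis using approx_domed_flip[of a "a + b" b c xs ys] assms by simp
qed

text \<open>An antipodal pair cannot be flipped, since the direction of its axis is lost under
  approximation; but \<open>y\<close> may be perturbed freely.\<close>

lemma approx_domed_antipodal_right:
  assumes C: "closed_steps (Suc n) (xs @ [w, y, - y] @ ys)"
  shows "approx_domed c (xs @ [w, y, - y] @ ys)"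
proof (rule approx_domed_limit)
  fix \<epsilon> :: real assume \<epsilon>: "\<epsilon> > 0"
  have "norm y = 1" "norm w = 1" using C unfolding closed_steps_def by auto
  then obtain y' where y': "norm y' = 1" "dist y y' < \<epsilon>" "w \<noteq> y'" "w \<noteq> - y'"
    using sphere_perturb \<epsilon> by metis
  have C1: "closed_steps (Suc n) (xs @ [w, y'] @ (- y') # ys)" "closed_steps (Suc n) (xs @ [y', w, - y'] @ ys)"
    using C y'(1) unfolding closed_steps_def by auto
  have "approx_domed c (xs @ [y', w, - y'] @ ys)"
    by (rule approx_domed_antipodal_around[OF C1(2) y'(3,4)])
  then have "approx_domed c (xs @ [w, y', - y'] @ ys)"
    using approx_domed_swap_neq[OF C1(1)] y'(4) by (simp add: eq_neg_iff_add_eq_0)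
  moreover have "dist (- y) (- y') < \<epsilon>" using y'(2) by (simp add: dist_norm norm_minus_commute)
  then have "list_all2 (\<lambda>x y. dist x y < \<epsilon>) (xs @ [w, y, - y] @ ys) (xs @ [w, y', - y'] @ ys)"
    using \<epsilon> y'(2) by (intro list_all2_appendI) (auto simp: list_all2_same)
  ultimately show "\<exists>ws. list_all2 (\<lambda>x y. dist x y < \<epsilon>) (xs @ [w, y, - y] @ ys) ws \<and> approx_domed c ws"
    by blast
qed

lemma approx_domed_antipodal_left:
  assumes C: "closed_steps (Suc n) (xs @ [y, - y, w] @ ys)"
  shows "approx_domed c (xs @ [y, - y, w] @ ys)"
proof (rule approx_domed_limit)
  fix \<epsilon> :: real assume \<epsilon>: "\<epsilon> > 0"
  have "norm y = 1" "norm w = 1" using C unfolding closed_steps_def by auto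
  then obtain y' where y': "norm y' = 1" "dist y y' < \<epsilon>" "w \<noteq> y'" "w \<noteq> - y'"
    using sphere_perturb \<epsilon> by metis
  have C1: "closed_steps (Suc n) ((xs @ [y']) @ [- y', w] @ ys)" "closed_steps (Suc n) (xs @ [y', w, - y'] @ ys)"
    using C y'(1) unfolding closed_steps_def by auto
  have "approx_domed c (xs @ [y', w, - y'] @ ys)"
    by (rule approx_domed_antipodal_around[OF C1(2) y'(3,4)])
  then have "approx_domed c (xs @ [y', - y', w] @ ys)"
    using approx_domed_swap_neq[OF C1(1)] y'(3) by simp
  moreover have "dist (- y) (- y') < \<epsilon>" using y'(2) by (simp add: dist_norm norm_minus_commute)
  then have "list_all2 (\<lambda>x y. dist x y < \<epsilon>) (xs @ [y, - y, w] @ ys) (xs @ [y', - y', w] @ ys)"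
    using \<epsilon> y'(2) by (intro list_all2_appendI) (auto simp: list_all2_same)
  ultimately show "\<exists>ws. list_all2 (\<lambda>x y. dist x y < \<epsilon>) (xs @ [y, - y, w] @ ys) ws \<and> approx_domed c ws"
    by blast
qed

lemma approx_domed_antipodal:
  assumes C: "closed_steps (Suc n) (xs @ [y, - y] @ ys)"
  shows "approx_domed c (xs @ [y, - y] @ ys)"
proof (cases ys)
  case (Cons w ys')
  then show ?thesis using approx_domed_antipodal_left[of xs y w ys'] C by simp
next
  case Nil
  \<comment> \<open>There are at least four edges, so the antipodal pair has a neighbour on at least
    one side.\<close>
  then have "xs \<noteq> []" using C n3 unfolding closed_steps_def by auto
  then obtain xs' w where "xs = xs' @ [w]" by (metis rev_exhaust)
  then show ?thesis using approx_domed_antipodal_right[of xs' w y ys] C by simp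
qed

lemma approx_domed_swap:
  assumes C: "closed_steps (Suc n) (xs @ [a, b] @ ys)" and A: "approx_domed c (xs @ [b, a] @ ys)"
  shows "approx_domed c (xs @ [a, b] @ ys)"
proof (cases "a + b = 0")
  case True
  then have "b = - a" by (simp add: eq_neg_iff_add_eq_0 add.commute)
  then show ?thesis using approx_domed_antipodal C by blast
next
  case False
  then show ?thesis using approx_domed_swap_neq C A by blast
qed

lemma approx_domed_move:
  assumes "closed_steps (Suc n) (xs @ ys @ [a] @ zs)" "approx_domed c (xs @ [a] @ ys @ zs)"
  shows "approx_domed c (xs @ ys @ [a] @ zs)"
  using assms
proof (induction ys arbitrary: xs)
  case (Cons y ys)
  have "mset (xs @ [y, a] @ ys @ zs) = mset (xs @ (y # ys) @ [a] @ zs)" by simp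
  then have "closed_steps (Suc n) (xs @ [y, a] @ ys @ zs)"
    using closed_steps_mset Cons.prems(1) by blast
  then have "approx_domed c (xs @ [y, a] @ ys @ zs)"
    by (rule approx_domed_swap) (use Cons.prems(2) in simp)
  then show ?case using Cons.IH[of "xs @ [y]"] Cons.prems(1) by simp
qed simp

text \<open>Sorting from the front: \<open>xs\<close> is the part already in place, and the next
  entry \<open>v\<close> is moved across \<open>u1\<close>.\<close>

lemma approx_domed_perm:
  assumes "closed_steps (Suc n) (xs @ us)" "mset us = mset vs" "approx_domed c (xs @ vs)"
  shows "approx_domed c (xs @ us)"
  using assms
proof (induction vs arbitrary: xs us)
  case (Cons v vs)
  have "v \<in> set us" using Cons.prems(2) by (metis list.set_intros(1) set_mset_mset)
  then obtain u1 u2 where us: "us = u1 @ [v] @ u2" by (metis append_Cons append_Nil split_list)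
  have ms: "mset (u1 @ u2) = mset vs" using Cons.prems(2) unfolding us by simp
  have "mset (xs @ us) = mset ((xs @ [v]) @ u1 @ u2)" unfolding us by simp
  then have "closed_steps (Suc n) ((xs @ [v]) @ u1 @ u2)" using closed_steps_mset Cons.prems(1) by blast
  then have "approx_domed c ((xs @ [v]) @ u1 @ u2)"
    by (rule Cons.IH[OF _ ms]) (use Cons.prems(3) in simp)
  then show ?case using approx_domed_move[of xs u1 v u2] Cons.prems(1) unfolding us by simp
qed simp

lemma approx_domed_step:
  assumes C: "closed_steps (Suc n) vs"
  shows "approx_domed c vs"
proof -
  let ?N = "Suc n"
  let ?v = "\<lambda>i. vs ! i"
  have len: "length vs = ?N" and unit: "\<And>i. i < ?N \<Longrightarrow> norm (?v i) = 1" and sum0: "(\<Sum>i<?N. ?v i) = 0"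
    using C unfolding closed_steps_def by (auto simp: sum_list_sum_nth atLeast0LessThan)
  have unit2: "?v i \<bullet> ?v i = 1" if "i < ?N" for i using unit[OF that] by (simp add: norm_eq_1)
  have perm: "approx_domed c vs" if "mset vs = mset us" "closed_steps ?N us \<Longrightarrow> approx_domed c us" for us
    using approx_domed_perm[of "[]" vs us] that C closed_steps_mset[OF that(1)] by auto
  have ms: "mset vs = image_mset ?v (mset_set {..<?N})"
    using len by (metis map_nth mset_map mset_upt atLeast0LessThan)
  \<comment> \<open>Distinct indices, rather than distinct vectors, are selected because edge
    vectors may repeat.\<close>
  have pick: "\<exists>R. mset vs = mset (map ?v is @ R)" if "distinct is" "set is \<subseteq> {..<?N}" for "is"
  proof -
    have "{..<?N} = set is \<union> ({..<?N} - set is)" using that(2) by auto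
    then have "mset_set {..<?N} = mset_set (set is) + mset_set ({..<?N} - set is)"
      by (metis Diff_disjoint finite_Diff finite_lessThan finite_set mset_set_Union)
    then have "mset vs = mset (map ?v is) + image_mset ?v (mset_set ({..<?N} - set is))"
      unfolding ms using that(1) by (simp add: mset_set_set)
    moreover obtain R where "mset R = image_mset ?v (mset_set ({..<?N} - set is))"
      using ex_mset by blast
    ultimately show ?thesis by (metis mset_append)
  qed
  have row: "(\<Sum>i\<in>{..<?N} - {k}. ?v i \<bullet> ?v k) = - 1" if "k < ?N" for k
  proof -
    have "(\<Sum>i<?N. ?v i \<bullet> ?v k) = 0" using sum0 by (metis inner_sum_left inner_zero_left)
    then show ?thesis using that unit2[OF that] sum.remove[of "{..<?N}" k "\<lambda>i. ?v i \<bullet> ?v k"] by simp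
  qed
  have hinge3: "approx_domed c vs"
    if ijk: "i < ?N" "j < ?N" "k < ?N" "i \<noteq> j" "i \<noteq> k" "j \<noteq> k" "?v i + ?v j \<noteq> 0"
      "e \<in> hinge (?v i + ?v j)" "?v k \<bullet> e = - 1/2" for i j k e
  proof -
    obtain R where R: "mset vs = mset (map ?v [i, j, k] @ R)" using pick[of "[i, j, k]"] ijk by auto
    show ?thesis
      using approx_domed_hinge_left[of "[]" "?v i" "?v j" "?v k" R e] ijk by (intro perm[OF R]) simp
  qed
  have in_hinge: "?v i \<in> hinge (?v i + ?v j)" "?v j \<in> hinge (?v i + ?v j)" if "i < ?N" "j < ?N" for i j
    using unit that unfolding hinge_def by auto
  \<comment> \<open>Antipodal pairs are settled first; afterwards every pair has a nonzero sum to
    rotate about.\<close>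
  show ?thesis
  proof (cases "\<exists>i j. i < ?N \<and> j < ?N \<and> i \<noteq> j \<and> ?v i + ?v j = 0")
    case True
    then obtain i j where ij: "i < ?N" "j < ?N" "i \<noteq> j" "?v i + ?v j = 0" by blast
    then have vj: "?v j = - ?v i" by (simp add: eq_neg_iff_add_eq_0 add.commute)
    obtain R where R: "mset vs = mset (map ?v [i, j] @ R)" using pick[of "[i, j]"] ij by auto
    show ?thesis using approx_domed_antipodal[of "[]" "?v i" R] vj by (intro perm[OF R]) simp
  next
    case False
    then have nz: "?v i + ?v j \<noteq> 0" if "i < ?N" "j < ?N" "i \<noteq> j" for i j using that by blast
    show ?thesis
    proof (cases "\<exists>i k. i < ?N \<and> k < ?N \<and> i \<noteq> k \<and> ?v i \<bullet> ?v k \<le> - 1/2")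
      case True
      then obtain i k where ik: "i < ?N" "k < ?N" "i \<noteq> k" "?v i \<bullet> ?v k \<le> - 1/2" by blast
      \<comment> \<open>Otherwise the \<open>n\<close> products with \<open>?v k\<close> would sum
        to at most \<open>- n / 2\<close>, while their sum is -1 and
        \<open>n \<ge> 3\<close>.\<close>
      have "\<exists>j\<in>{..<?N} - {k}. ?v j \<bullet> ?v k > - 1/2"
      proof (rule ccontr)
        assume "\<not> ?thesis"
        then have "(\<Sum>j\<in>{..<?N} - {k}. ?v j \<bullet> ?v k) \<le> (\<Sum>j\<in>{..<?N} - {k}. - 1/2)"
          by (intro sum_mono) (auto simp: not_less)
        also have "\<dots> = - real n / 2" using ik(2) by simp
        finally show False using row[OF ik(2)] n3 by simp
      qed
      then obtain j where j: "j < ?N" "j \<noteq> k" "?v j \<bullet> ?v k > - 1/2" by auto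
      have ji: "j \<noteq> i" using ik(4) j(3) by auto
      \<comment> \<open>On this circle the product with \<open>?v k\<close> is at most -1/2 at
        \<open>?v i\<close> and larger at \<open>?v j\<close>.\<close>
      obtain e where e: "e \<in> hinge (?v i + ?v j)" "?v k \<bullet> e = - 1/2"
        using hinge_IVT[OF in_hinge(2)[OF ik(1) j(1)] in_hinge(1)[OF ik(1) j(1)] nz[OF ik(1) j(1)], of "?v k" "- 1/2"]
          ji ik(4) j(3) by (auto simp: inner_commute)
      show ?thesis using hinge3[OF ik(1) j(1) ik(2) _ ik(3) j(2) nz[OF ik(1) j(1)] e] ji by auto
    next
      case F2: False
      then have big: "?v i \<bullet> ?v k > - 1/2" if "i < ?N" "k < ?N" "i \<noteq> k" for i k
        using that by force
      \<comment> \<open>The index \<open>0\<close> is an arbitrary choice: the products of any edge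
        vector with the others sum to -1, so one of them is not positive.\<close>
      have "\<exists>i\<in>{..<?N} - {0}. ?v i \<bullet> ?v 0 \<le> 0"
      proof (rule ccontr)
        assume "\<not> ?thesis"
        then have "(\<Sum>i\<in>{..<?N} - {0}. ?v i \<bullet> ?v 0) \<ge> 0" by (intro sum_nonneg) (meson linear)
        then show False using row[of 0] by simp
      qed
      then obtain i where i: "i < ?N" "i \<noteq> 0" "?v i \<bullet> ?v 0 \<le> 0" by auto
      define s where "s = ?v i + ?v 0"
      have ss: "s \<bullet> s = 2 + 2 * (?v i \<bullet> ?v 0)"
        unfolding s_def using unit2 i by (simp add: inner_add_left inner_add_right inner_commute)
      have big0: "?v i \<bullet> ?v 0 > - 1/2" using big i by simp
      have "1\<^sup>2 \<le> (norm s)\<^sup>2" "(norm s)\<^sup>2 \<le> 2" using ss big0 i(3) by (simp_all add: power2_norm_eq_inner)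
      \<comment> \<open>The bounds -1/2 and 0 on the product \<open>?v i \<bullet> ?v 0\<close> give
        exactly the range of lengths that \<open>hinge_far_point\<close> asks for.\<close>
      then have ns: "1 \<le> norm s" "(norm s)\<^sup>2 \<le> 2" using power2_le_imp_le norm_ge_zero by blast+
      \<comment> \<open>All products with \<open>s\<close> sum to 0, and \<open>?v i\<close> and
        \<open>?v 0\<close> together contribute \<open>s \<bullet> s > 0\<close>.\<close>
      have "\<exists>k\<in>{..<?N} - {i} - {0}. ?v k \<bullet> s \<le> 0"
      proof (rule ccontr)
        assume "\<not> ?thesis"
        then have pos: "(\<Sum>k\<in>{..<?N} - {i} - {0}. ?v k \<bullet> s) \<ge> 0" by (intro sum_nonneg) (meson linear)
        have "(\<Sum>k<?N. ?v k \<bullet> s) = 0" using sum0 by (metis inner_sum_left inner_zero_left)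
        moreover have "(\<Sum>k<?N. ?v k \<bullet> s) = ?v i \<bullet> s + (?v 0 \<bullet> s + (\<Sum>k\<in>{..<?N} - {i} - {0}. ?v k \<bullet> s))"
          using i sum.remove[of "{..<?N}" i "\<lambda>k. ?v k \<bullet> s"] sum.remove[of "{..<?N} - {i}" 0 "\<lambda>k. ?v k \<bullet> s"]
          by simp
        moreover have "?v i \<bullet> s + ?v 0 \<bullet> s = s \<bullet> s" unfolding s_def by (simp add: inner_add_left)
        ultimately show False using pos ss big0 by linarith
      qed
      then obtain k where k: "k < ?N" "k \<noteq> i" "k \<noteq> 0" "?v k \<bullet> s \<le> 0" by auto
      obtain e0 where e0: "e0 \<in> hinge s" "?v k \<bullet> e0 \<le> - 1/2"
        using hinge_far_point[OF _ ns unit[OF k(1)] k(4)] in_hinge(1)[OF i(1), of 0] unfolding s_def by auto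
      \<comment> \<open>\<open>?v i\<close> lies on the same circle as \<open>e0\<close>, on the
        other side of the value -1/2.\<close>
      have "?v k \<bullet> ?v i \<ge> - 1/2" using big[OF k(1) i(1) k(2)] by simp
      then obtain e where "e \<in> hinge s" "?v k \<bullet> e = - 1/2"
        using hinge_IVT[OF _ e0(1), of "?v i" "?v k" "- 1/2"] in_hinge(1)[OF i(1), of 0] e0(2) nz[OF i(1), of 0] i(2)
        unfolding s_def by auto
      then show ?thesis using hinge3[of i 0 k e] i k nz[OF i(1), of 0] unfolding s_def by auto
    qed
  qed
qed

end

section \<open>The induction and the return from edge vectors to vertices\<close>

lemma all_approx_domed:
  assumes "n \<ge> 3" "closed_steps n us"
  shows "approx_domed c us"
  using assms
proof (induction n arbitrary: us rule: nat_induct_at_least)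
  case base
  then obtain a b d where us: "us = [a, b, d]"
    unfolding closed_steps_def by (auto simp: length_Suc_conv numeral_3_eq_3)
  \<comment> \<open>A closed curve of three unit edges is an equilateral triangle.\<close>
  have "domed_steps c us" unfolding us
    by (rule domed_steps_triangle) (use base in \<open>auto simp: us closed_steps_def add.assoc\<close>)
  moreover have "list_all2 (\<lambda>x y. dist x y < \<epsilon>) us us" if "\<epsilon> > 0" for \<epsilon> :: real
    using that by (simp add: list_all2_same)
  ultimately show ?case unfolding approx_domed_def by blast
next
  case (Suc n)
  then show ?case using approx_domed_step by blast
qed

text \<open>Translates the list convention, with the first vertex repeated at the end, into indices
  modulo \<open>n\<close>.\<close>

lemma dome_can_be_domed:
  assumes d: "dome T bs f" and len: "length bs = Suc n" and n: "n > 0"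
  shows "can_be_domed n (\<lambda>i. f (bs ! i))" and "integral_curve n (\<lambda>i. f (bs ! i))"
proof -
  have S: "surface_complex T" and hl: "hd bs = last bs" and dis: "distinct (tl bs)"
    and V: "set bs \<subseteq> \<Union>T" 
    and bd: "set (path_edges bs) = cx_boundary_edges T"
    and unit: "\<And>x y. {x, y} \<in> cx_edges T \<Longrightarrow> dist (f x) (f y) = 1"
    using d unfolding dome_def by blast+
  have wrap: "bs ! (Suc i mod n) = bs ! Suc i" if "i < n" for i
  proof (cases "Suc i = n")
    case True
    have "bs \<noteq> []" using len by auto
    then show ?thesis using hl True len by (simp add: hd_conv_nth last_conv_nth)
  qed (use that in simp)
  have "inj_on ((!) bs) {..<n}"
  proof (rule inj_onI)
    fix i j assume ij: "i \<in> {..<n}" "j \<in> {..<n}" "bs ! i = bs ! j"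
    \<comment> \<open>Distinctness is known for \<open>tl bs\<close>, where vertex \<open>i\<close>
      stands at place \<open>i - 1\<close>, and vertex \<open>0\<close> at place
      \<open>n - 1\<close> as the repeated last entry.\<close>
    define p where "p i = (if i = 0 then n - 1 else i - 1)" for i
    have p: "tl bs ! p i = bs ! i" "p i < n" if "i < n" for i
    proof -
      have "bs ! n = bs ! 0" using wrap[of "n - 1"] n by simp
      then show "tl bs ! p i = bs ! i" "p i < n"
        using that len n unfolding p_def by (auto simp: nth_tl)
    qed
    have "p i = p j"
      using dis ij p[of i] p[of j] len nth_eq_iff_index_eq[of "tl bs" "p i" "p j"] by simp
    then show "i = j" using ij unfolding p_def by (auto split: if_splits)
  qed
  moreover have "(!) bs ` {..<n} \<subseteq> \<Union>T" 
    using V len by (intro image_subsetI subsetD[OF V] nth_mem) simp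
  moreover have B: "cx_boundary_edges T = {{bs ! i, bs ! (Suc i mod n)} | i. i < n}"
    unfolding bd[symmetric] path_edges_conv_nth using len wrap by (auto simp: image_iff)
  ultimately have "boundary_cycle T n ((!) bs)" unfolding boundary_cycle_def by blast
  then show "can_be_domed n (\<lambda>i. f (bs ! i))"
    unfolding can_be_domed_def is_dome_def using S unit by blast
  have "{bs ! i, bs ! (Suc i mod n)} \<in> cx_edges T" if "i < n" for i
    using boundary_edge_in_edges B that by blast
  then show "integral_curve n (\<lambda>i. f (bs ! i))" unfolding integral_curve_def using unit by blast
qed

lemma dist_sum_list_le:
  assumes "list_all2 (\<lambda>x y. dist x y < \<delta>) us (ws :: point3 list)"
  shows "dist (sum_list us) (sum_list ws) \<le> real (length us) * \<delta>"
  using assms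
proof (induction rule: list_all2_induct)
  case (Cons x xs y ys)
  have "dist (x + sum_list xs) (y + sum_list ys) \<le> dist x y + dist (sum_list xs) (sum_list ys)"
    by (rule dist_triangle_add)
  then show ?case using Cons by (simp add: algebra_simps)
qed simp

theorem theorem1p2:
  fixes n :: nat and v :: "nat \<Rightarrow> real ^ 3" and \<epsilon> :: real
  assumes "n \<ge> 3" and "integral_curve n v" and "\<epsilon> > 0"
  shows "\<exists>w :: nat \<Rightarrow> real ^ 3. integral_curve n w \<and> frechet_dist n v w < \<epsilon> \<and> can_be_domed n w"
proof -
  define us where "us = map (\<lambda>i. v (Suc i mod n) - v i) [0..<n]"
  have prefix: "sum_list (take i us) = v i - v 0" if "i < n" for i
    using that
  proof (induction i)
    case (Suc i)
    then have "take (Suc i) us = take i us @ [v (Suc i) - v i]"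
      unfolding us_def by (simp add: take_Suc_conv_app_nth)
    then show ?case using Suc by simp
  qed simp
  have len: "length us = n" unfolding us_def by simp
  \<comment> \<open>The last edge wraps round to vertex \<open>0\<close>; it is split off because
    the prefix sums are known only below \<open>n\<close>.\<close>
  have "us = take (n - 1) us @ [v 0 - v (n - 1)]"
  proof -
    have "us = take (Suc (n - 1)) us" using len assms(1) by simp
    also have "\<dots> = take (n - 1) us @ [us ! (n - 1)]"
      using len assms(1) by (intro take_Suc_conv_app_nth) simp
    also have "us ! (n - 1) = v 0 - v (n - 1)" unfolding us_def using assms(1) by simp
    finally show ?thesis .
  qed
  then have "sum_list us = sum_list (take (n - 1) us) + (v 0 - v (n - 1))"
    by (metis sum_list_append sum_list.Cons sum_list.Nil add.right_neutral)
  then have "sum_list us = 0" using prefix[of "n - 1"] assms(1) by simp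
  moreover have "\<forall>u\<in>set us. norm u = 1"
    using assms(2) unfolding us_def integral_curve_def by (auto simp: dist_norm norm_minus_commute)
  ultimately have "closed_steps n us" using len unfolding closed_steps_def by simp
  then have A: "approx_domed (v 0) us" by (rule all_approx_domed[OF assms(1)])
  \<comment> \<open>Each vertex collects the errors of at most \<open>n\<close> edges; the factor 2
    leaves room for a strict inequality.\<close>
  define \<delta> where "\<delta> = \<epsilon> / (2 * real n)"
  have \<delta>: "\<delta> > 0" "real n * \<delta> < \<epsilon>" unfolding \<delta>_def using assms by (auto simp: field_simps)
  obtain ws where ws: "list_all2 (\<lambda>x y. dist x y < \<delta>) us ws" "domed_steps (v 0) ws"
    using A \<delta>(1) unfolding approx_domed_def by blast
  have lenw: "length ws = n" using ws(1) len by (simp add: list_all2_lengthD)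
  obtain T bs f where d: "dome T bs f" and m: "map f bs = polyline (v 0) ws"
    using ws(2) unfolding domed_steps_def by blast
  have lenb: "length bs = Suc n" using m lenw by (metis length_map length_polyline)
  define w where "w i = f (bs ! i)" for i
  have w: "w i = v 0 + sum_list (take i ws)" if "i < n" for i
  proof -
    have "w i = map f bs ! i" unfolding w_def using that lenb by simp
    then show ?thesis unfolding m using polyline_nth[of i ws "v 0"] that lenw by simp
  qed
  have close: "dist (v i) (w i) < \<epsilon>" if "i < n" for i
  proof -
    have "v i = v 0 + sum_list (take i us)" using prefix[OF that] by simp
    then have "dist (v i) (w i) = dist (sum_list (take i us)) (sum_list (take i ws))"
      using w[OF that] by (metis dist_add_cancel)
    also have "\<dots> \<le> real (length (take i us)) * \<delta>"
      by (rule dist_sum_list_le) (rule list_all2_takeI[OF ws(1)])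
    also have "\<dots> \<le> real n * \<delta>" using \<delta>(1) len by (intro mult_right_mono) auto
    finally show ?thesis using \<delta>(2) by simp
  qed
  have "frechet_dist n v w < \<epsilon>"
  proof -
    have "{dist (v i) (w i) | i. i < n} = (\<lambda>i. dist (v i) (w i)) ` {..<n}" by auto
    then show ?thesis unfolding frechet_dist_def using close assms(1) by (simp add: lessThan_empty_iff)
  qed
  moreover have "can_be_domed n w" "integral_curve n w"
    using dome_can_be_domed[OF d lenb] assms(1) unfolding w_def by auto
  ultimately show ?thesis by blast
qed

end
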